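(* Let $\mu>0$ and $H_{\max}>1$ be constants, and let constants $\sigma,q,k,\gamma,\beta>0$, $\lambda\in[0,1]$ be given. Let $T>0$ be a given constant and let $(\xi(t),w(t),h[t],v[t],\zeta(t),z(t))\in X\times\mathbb R^2$, $t\in[0,T]$, be a classical smooth solution of the PDE-ODE system $$\dot\xi=w,\quad \dot w=-f,\quad h_t+(hv)_x=0,\quad (hv)_t+\left(hv^2+\tfrac12h^2\right)_x=\mu(hv_x)_x+hf,\quad x\in[0,1],$$ $$v(t,0)=v(t,1)=0,\qquad \int_0^1h(t,x)\,dx=1,$$ $$\dot\zeta=-\gamma\zeta-\gamma^2\xi-f,$$ $$\dot z=f-\tfrac12\left(h^2(t,1)-h^2(t,0)\right)-\beta\left(z-\mu(h(t,1)-h(t,0))\right),$$ $$f=-\sigma\left(2\lambda z+(1-2\lambda)\mu(h(t,1)-h(t,0))-q(\zeta+(\gamma+k)\xi)\right).$$ Then there exists a constant $\bar M>0$ such that the following estimate holds for all sufficiently small $\delta t\in(0,T)$, $\delta x=1/n$: $$\begin{aligned}&|\xi^+-\xi(\delta t)|+|w^+-w(\delta t)|+|z^+-z(\delta t)|+|\zeta^+-\zeta(\delta t)|\\&\quad+\max_{i=0,\dots,n}\left(|h_i^+-h(\delta t,i\delta x)|+|v_i^+-v(\delta t,i\delta x)|\right)\le\bar M\,\delta t\left(\delta t+(\delta x)^2\right),\end{aligned}$$ where $n\ge2$ is an integer and $h_i^+,v_i^+$ $(i=0,\dots,n)$, $w^+,\xi^+,z^+,\zeta^+$ are given by one step of the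 finite-difference scheme described in the context, with $h_i=h(0,i\delta x)$, $v_i=v(0,i\delta x)$ for $i=0,\dots,n$, $w=w(0)$, $\xi=\xi(0)$, $\zeta=\zeta(0)$ and $z=z(0)$.
   Context: Finite-difference scheme (time step $\delta t>0$, space step $\delta x=1/n$, $n\ge 2$ an integer): $$h_0^+=h_0\exp\left(\tfrac{\delta t}{2\delta x}(v_2-4v_1)\right),\qquad h_n^+=h_n\exp\left(\tfrac{\delta t}{2\delta x}(4v_{n-1}-v_{n-2})\right),$$ $$h_i^+=h_i\exp\left(\tfrac{\delta t}{2\delta x}(v_{i-1}-v_{i+1})+\tfrac{\delta t}{2\delta x}v_i\ln\tfrac{h_{i-1}}{h_{i+1}}\right),\quad i=1,\dots,n-1,$$ $$\begin{aligned}v_i^+=&\left(1-\tfrac{2\delta t\,\mu}{(\delta x)^2}\right)v_i+\tfrac{\delta t\,\mu}{(\delta x)^2}(v_{i+1}+v_{i-1})+\tfrac{\delta t\,\mu}{4(\delta x)^2}(v_{i+1}-v_{i-1})\ln\tfrac{h_{i+1}}{h_{i-1}}\\&-\tfrac{\delta t}{2\delta x}\left(v_i(v_{i+1}-v_{i-1})+h_{i+1}-h_{i-1}\right)+f\,\delta t,\quad i=1,\dots,n-1,\end{aligned}$$ $$v_0^+=v_n^+=0,$$ $$f=-\sigma\left(2\lambda z+(1-2\lambda)\mu(h_n-h_0)-q(\zeta+(\gamma+k)\xi)\right),$$ $$\xi^+=\xi+\delta t\,w-\tfrac{(\delta t)^2}{2}f,\qquad w^+=w-\delta t\,f,\qquad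 \zeta^+=w^+-\gamma\xi^++e^{-\gamma\delta t}(\zeta-w+\gamma\xi),$$ $$z^+=z+\delta t\left(f-\tfrac12(h_n^2-h_0^2)-\beta\left(z-\mu(h_n-h_0)\right)\right).$$ The constant $\bar M$ may depend on the solution, on $T$ and on the parameters, but not on $\delta t$ or $n$. Notation: $u[t]$ is the profile $x\mapsto u(t,x)$. The set $S$ consists of all $(\xi,w,h,v)$ with $(\xi,w)\in\mathbb R^2$, $h\in C^0([0,1];(0,+\infty))\cap H^1(0,1)$, $v\in C^0([0,1])$, $v(0)=v(1)=0$, $\int_0^1h\,dx=1$; $X:=\{(\xi,w,h,v)\in S:V(\xi,w,h,v)<R\}$, where $$V(\xi,w,h,v):=\tfrac12\int_0^1h^{-1}(hv+\mu h_x)^2dx+\tfrac12\int_0^1hv^2dx+\int_0^1(h-1)^2dx+\tfrac{qk^2}2\xi^2+\tfrac q2(w+k\xi)^2,$$ $$R:=\tfrac{2\mu}{3}\left(2+\sqrt{H_{\max}}\min(H_{\max}-3,0)\right).$$ "Classical smooth solution" means a solution (with $h>0$) whose components have continuous derivatives of sufficiently large order, for $h,v$ on $[0,T]\times[0,1]$ and for $\xi,w,\zeta,z$ on $[0,T]$. *)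

theory Defs
  imports "HOL-Analysis.Analysis"
begin

(* Functions with continuous derivatives up to order k on S. Derivatives are taken within S, so at
   boundary points they are one-sided; the notion is intended for sets on which such derivatives
   are unique (the whole space, nondegenerate compact intervals and rectangles). *)
primrec Ck_on :: "nat \<Rightarrow> 'a::euclidean_space set \<Rightarrow> ('a \<Rightarrow> real) \<Rightarrow> bool" where
  "Ck_on 0 S g \<longleftrightarrow> continuous_on S g"
| "Ck_on (Suc k) S g \<longleftrightarrow> continuous_on S g \<and>
     (\<exists>D. (\<forall>x\<in>S. (g has_derivative D x) (at x within S)) \<and> (\<forall>u. Ck_on k S (\<lambda>x. D x u)))"

definition test_function :: "(real \<Rightarrow> real) \<Rightarrow> bool" where
  "test_function \<phi> \<longleftrightarrow> (\<forall>k. Ck_on k UNIV \<phi>) \<and> closure {x. \<phi> x \<noteq> 0} \<subseteq> {0<..<1}"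

definition L2_unit :: "(real \<Rightarrow> real) \<Rightarrow> bool" where
  "L2_unit g \<longleftrightarrow> set_borel_measurable lborel {0<..<1} g \<and>
     set_integrable lborel {0<..<1} (\<lambda>x. (g x)\<^sup>2)"

definition has_weak_deriv :: "(real \<Rightarrow> real) \<Rightarrow> (real \<Rightarrow> real) \<Rightarrow> bool" where
  "has_weak_deriv g g' \<longleftrightarrow> (\<forall>\<phi>. test_function \<phi> \<longrightarrow>
     (LBINT x:{0<..<1}. g x * deriv \<phi> x) = - (LBINT x:{0<..<1}. g' x * \<phi> x))"

definition H1_unit :: "(real \<Rightarrow> real) \<Rightarrow> bool" where
  "H1_unit g \<longleftrightarrow> L2_unit g \<and> (\<exists>g'. L2_unit g' \<and> has_weak_deriv g g')"

(* A representative of the weak derivative; it is unique up to null sets, so integrals involving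
   it do not depend on the choice. *)
definition weak_deriv :: "(real \<Rightarrow> real) \<Rightarrow> real \<Rightarrow> real" where
  "weak_deriv g = (SOME g'. L2_unit g' \<and> has_weak_deriv g g')"

(* Profiles are total functions of which only the values on [0,1] matter. *)
type_synonym state = "real \<times> real \<times> (real \<Rightarrow> real) \<times> (real \<Rightarrow> real)"

definition S_space :: "state set" where
  "S_space = {(\<xi>, w, h, v).
     continuous_on {0..1} h \<and> (\<forall>x\<in>{0..1}. h x > 0) \<and> H1_unit h \<and>
     continuous_on {0..1} v \<and> v 0 = 0 \<and> v 1 = 0 \<and> (LBINT x:{0..1}. h x) = 1}"

definition V_fun :: "real \<Rightarrow> real \<Rightarrow> real \<Rightarrow> state \<Rightarrow> real" where
  "V_fun \<mu> q k = (\<lambda>(\<xi>, w, h, v).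
     1/2 * (LBINT x:{0..1}. inverse (h x) * (h x * v x + \<mu> * weak_deriv h x)\<^sup>2)
     + 1/2 * (LBINT x:{0..1}. h x * (v x)\<^sup>2)
     + (LBINT x:{0..1}. (h x - 1)\<^sup>2)
     + q * k\<^sup>2 / 2 * \<xi>\<^sup>2 + q / 2 * (w + k * \<xi>)\<^sup>2)"

definition R_const :: "real \<Rightarrow> real \<Rightarrow> real" where
  "R_const \<mu> Hmax = 2 * \<mu> / 3 * (2 + sqrt Hmax * min (Hmax - 3) 0)"

definition X_space :: "real \<Rightarrow> real \<Rightarrow> real \<Rightarrow> real \<Rightarrow> state set" where
  "X_space \<mu> q k Hmax = {s \<in> S_space. V_fun \<mu> q k s < R_const \<mu> Hmax}"

(* lam is the weight lambda; hL and hR stand for the liquid level at x = 0 and x = 1. *)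
definition feedback ::
  "real \<Rightarrow> real \<Rightarrow> real \<Rightarrow> real \<Rightarrow> real \<Rightarrow> real \<Rightarrow> real \<Rightarrow> real \<Rightarrow> real \<Rightarrow> real \<Rightarrow> real \<Rightarrow> real" where
  "feedback \<mu> \<sigma> q k \<gamma> lam \<xi> \<zeta> z hL hR =
     - \<sigma> * (2 * lam * z + (1 - 2 * lam) * \<mu> * (hR - hL) - q * (\<zeta> + (\<gamma> + k) * \<xi>))"

(* Partial derivatives of g(t,x) on [0,T] x [0,1], one-sided at the boundary. *)
definition pd_t :: "real \<Rightarrow> (real \<Rightarrow> real \<Rightarrow> real) \<Rightarrow> real \<Rightarrow> real \<Rightarrow> real" where
  "pd_t T g t x = vector_derivative (\<lambda>s. g s x) (at t within {0..T})"

definition pd_x :: "(real \<Rightarrow> real \<Rightarrow> real) \<Rightarrow> real \<Rightarrow> real \<Rightarrow> real" where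
  "pd_x g t x = vector_derivative (\<lambda>y. g t y) (at x within {0..1})"

(* Classical solution on [0,T] all of whose components are of class C^N. For N at least 2 every
   partial derivative occurring below exists. *)
definition classical_solution ::
  "nat \<Rightarrow> real \<Rightarrow> real \<Rightarrow> real \<Rightarrow> real \<Rightarrow> real \<Rightarrow> real \<Rightarrow> real \<Rightarrow> real \<Rightarrow>
   (real \<Rightarrow> real) \<Rightarrow> (real \<Rightarrow> real) \<Rightarrow> (real \<Rightarrow> real \<Rightarrow> real) \<Rightarrow> (real \<Rightarrow> real \<Rightarrow> real) \<Rightarrow>
   (real \<Rightarrow> real) \<Rightarrow> (real \<Rightarrow> real) \<Rightarrow> bool" where
  "classical_solution N T \<mu> \<sigma> q k \<gamma> \<beta> lam \<xi> w h v \<zeta> z \<longleftrightarrow>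
     (let f = (\<lambda>t. feedback \<mu> \<sigma> q k \<gamma> lam (\<xi> t) (\<zeta> t) (z t) (h t 0) (h t 1)) in
     Ck_on N {0..T} \<xi> \<and> Ck_on N {0..T} w \<and> Ck_on N {0..T} \<zeta> \<and> Ck_on N {0..T} z \<and>
     Ck_on N ({0..T} \<times> {0..1}) (\<lambda>(t, x). h t x) \<and>
     Ck_on N ({0..T} \<times> {0..1}) (\<lambda>(t, x). v t x) \<and>
     (\<forall>t\<in>{0..T}.
        (\<xi> has_real_derivative w t) (at t within {0..T}) \<and>
        (w has_real_derivative - f t) (at t within {0..T}) \<and>
        (\<forall>x\<in>{0..1}.
           h t x > 0 \<and>
           pd_t T h t x + pd_x (\<lambda>t x. h t x * v t x) t x = 0 \<and>
           pd_t T (\<lambda>t x. h t x * v t x) t x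
             + pd_x (\<lambda>t x. h t x * (v t x)\<^sup>2 + 1/2 * (h t x)\<^sup>2) t x
           = \<mu> * pd_x (\<lambda>t x. h t x * pd_x v t x) t x + h t x * f t) \<and>
        v t 0 = 0 \<and> v t 1 = 0 \<and> (LBINT x:{0..1}. h t x) = 1 \<and>
        (\<zeta> has_real_derivative (- \<gamma> * \<zeta> t - \<gamma>\<^sup>2 * \<xi> t - f t)) (at t within {0..T}) \<and>
        (z has_real_derivative
           (f t - 1/2 * ((h t 1)\<^sup>2 - (h t 0)\<^sup>2) - \<beta> * (z t - \<mu> * (h t 1 - h t 0))))
          (at t within {0..T})))"

(* One step of the finite-difference scheme. Grid functions have type nat => real; only the
   indices 0, ..., n matter, and dx is meant to be 1/n. *)

definition step_h ::
  "real \<Rightarrow> real \<Rightarrow> nat \<Rightarrow> (nat \<Rightarrow> real) \<Rightarrow> (nat \<Rightarrow> real) \<Rightarrow> nat \<Rightarrow> real" where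
  "step_h dt dx n h v i =
     (if i = 0 then h 0 * exp (dt / (2 * dx) * (v 2 - 4 * v 1))
      else if i = n then h n * exp (dt / (2 * dx) * (4 * v (n - 1) - v (n - 2)))
      else h i * exp (dt / (2 * dx) * (v (i - 1) - v (i + 1))
                      + dt / (2 * dx) * v i * ln (h (i - 1) / h (i + 1))))"

definition step_v ::
  "real \<Rightarrow> real \<Rightarrow> real \<Rightarrow> nat \<Rightarrow> real \<Rightarrow> (nat \<Rightarrow> real) \<Rightarrow> (nat \<Rightarrow> real) \<Rightarrow> nat \<Rightarrow> real" where
  "step_v \<mu> dt dx n f h v i =
     (if i = 0 \<or> i = n then 0
      else (1 - 2 * dt * \<mu> / dx\<^sup>2) * v i
           + dt * \<mu> / dx\<^sup>2 * (v (i + 1) + v (i - 1))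
           + dt * \<mu> / (4 * dx\<^sup>2) * (v (i + 1) - v (i - 1)) * ln (h (i + 1) / h (i - 1))
           - dt / (2 * dx) * (v i * (v (i + 1) - v (i - 1)) + h (i + 1) - h (i - 1))
           + f * dt)"

definition step_xi :: "real \<Rightarrow> real \<Rightarrow> real \<Rightarrow> real \<Rightarrow> real" where
  "step_xi dt f \<xi> w = \<xi> + dt * w - dt\<^sup>2 / 2 * f"

definition step_w :: "real \<Rightarrow> real \<Rightarrow> real \<Rightarrow> real" where
  "step_w dt f w = w - dt * f"

definition step_zeta :: "real \<Rightarrow> real \<Rightarrow> real \<Rightarrow> real \<Rightarrow> real \<Rightarrow> real \<Rightarrow> real" where
  "step_zeta \<gamma> dt f \<xi> w \<zeta> =
     step_w dt f w - \<gamma> * step_xi dt f \<xi> w + exp (- \<gamma> * dt) * (\<zeta> - w + \<gamma> * \<xi>)"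

definition step_z :: "real \<Rightarrow> real \<Rightarrow> real \<Rightarrow> real \<Rightarrow> real \<Rightarrow> real \<Rightarrow> real \<Rightarrow> real" where
  "step_z \<mu> \<beta> dt f z hL hR =
     z + dt * (f - 1/2 * (hR\<^sup>2 - hL\<^sup>2) - \<beta> * (z - \<mu> * (hR - hL)))"

end

theory Submission
  imports Defs
begin

text \<open>The scheme is an exponential Euler step for \<open>(ln h)\<^sub>t = - (v\<^sub>x + v (ln h)\<^sub>x)\<close> and an Euler step for
  \<open>v\<^sub>t = \<mu> (v\<^sub>x\<^sub>x + v\<^sub>x (ln h)\<^sub>x) - v v\<^sub>x - h\<^sub>x + f\<close>, with every space derivative replaced by a difference
  quotient of second order; at the walls the quotients are the one-sided three-point ones, with
  \<open>v = 0\<close> used to drop a term. Taylor expansion in time costs \<open>O(\<delta>t\<^sup>2)\<close> and in space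
  \<open>\<delta>t O(\<delta>x\<^sup>2)\<close>. Both are uniform because the derivatives are bounded on a compact rectangle; the
  second difference of \<open>v\<close> needs four of them, so \<open>C\<^sup>4\<close> suffices.\<close>

section \<open>Iterated derivatives along a fixed direction\<close>

text \<open>\<open>Ck_on\<close> hides each derivative behind its own existential quantifier,
  whereas Taylor's theorem needs one sequence of functions, each the derivative of its predecessor.
  Fixing a direction \<open>u\<close> and recursing into \<open>D x u\<close> produces it. The set
  \<open>I\<close> is arbitrary so that the same statement serves an interval and the time and space
  slices of a rectangle.\<close>

lemma Ck_on_directional:
  fixes g :: "'a::euclidean_space \<Rightarrow> real"
  assumes "Ck_on k S g"
  shows "\<exists>G. G 0 = g \<and> (\<forall>j\<le>k. continuous_on S (G j)) \<and>
    (\<forall>j<k. \<forall>p I. (\<forall>s\<in>I. p + s *\<^sub>R u \<in> S) \<longrightarrow>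
       (\<forall>s\<in>I. ((\<lambda>s. G j (p + s *\<^sub>R u)) has_real_derivative G (Suc j) (p + s *\<^sub>R u)) (at s within I)))"
  using assms
proof (induction k arbitrary: g)
  case 0
  then show ?case by (intro exI[of _ "\<lambda>_. g"]) auto
next
  case (Suc k)
  then obtain D where cont: "continuous_on S g"
    and D: "\<And>x. x \<in> S \<Longrightarrow> (g has_derivative D x) (at x within S)"
    and Ck: "Ck_on k S (\<lambda>x. D x u)"
    unfolding Ck_on.simps by blast
  obtain G where G0: "G 0 = (\<lambda>x. D x u)" and G: "\<And>j. j \<le> k \<Longrightarrow> continuous_on S (G j)"
    and GD: "\<And>j p I s. j < k \<Longrightarrow> (\<forall>s\<in>I. p + s *\<^sub>R u \<in> S) \<Longrightarrow> s \<in> I \<Longrightarrow>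
       ((\<lambda>s. G j (p + s *\<^sub>R u)) has_real_derivative G (Suc j) (p + s *\<^sub>R u)) (at s within I)"
    using Suc.IH[OF Ck] by metis
  have step: "((\<lambda>s. g (p + s *\<^sub>R u)) has_real_derivative D (p + s *\<^sub>R u) u) (at s within I)"
    if I: "\<forall>s\<in>I. p + s *\<^sub>R u \<in> S" and s: "s \<in> I" for p I s
  proof -
    have "(g has_derivative D (p + s *\<^sub>R u)) (at (p + s *\<^sub>R u) within (\<lambda>s. p + s *\<^sub>R u) ` I)"
      using D[of "p + s *\<^sub>R u"] I s by (auto intro: has_derivative_subset)
    moreover have "((\<lambda>s. p + s *\<^sub>R u) has_derivative (\<lambda>s. s *\<^sub>R u)) (at s within I)"
      by (auto intro!: derivative_eq_intros)
    ultimately have "((\<lambda>s. g (p + s *\<^sub>R u)) has_derivative (\<lambda>r. D (p + s *\<^sub>R u) (r *\<^sub>R u))) (at s within I)"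
      using has_derivative_in_compose by blast
    moreover have "D (p + s *\<^sub>R u) (r *\<^sub>R u) = D (p + s *\<^sub>R u) u * r" for r
      using linear_scale[OF has_derivative_linear[OF D[of "p + s *\<^sub>R u"]]] I s by simp
    ultimately show ?thesis by (simp add: has_field_derivative_def)
  qed
  show ?case
  proof (intro exI[of _ "case_nat g G"] conjI allI impI ballI)
    fix j assume "j \<le> Suc k"
    then show "continuous_on S (case_nat g G j)" using cont G by (cases j) auto
  next
    fix j p I s assume "j < Suc k" "\<forall>s\<in>I. p + s *\<^sub>R u \<in> S" "s \<in> I"
    then show "((\<lambda>s. case_nat g G j (p + s *\<^sub>R u)) has_real_derivative
        case_nat g G (Suc j) (p + s *\<^sub>R u)) (at s within I)"
      using step GD by (cases j) (auto simp: G0)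
  qed simp
qed

section \<open>Taylor remainders and difference quotients\<close>

lemma continuous_on_compact_abs_bound:
  fixes f :: "'a::topological_space \<Rightarrow> real"
  assumes "compact S" "continuous_on S f"
  obtains B where "B > 0" "\<And>x. x \<in> S \<Longrightarrow> \<bar>f x\<bar> \<le> B"
proof -
  have "bounded (f ` S)"
    using assms by (intro compact_imp_bounded compact_continuous_image)
  then show thesis using that unfolding bounded_pos by auto
qed

text \<open>Compactness bounds \<open>F (Suc m)\<close>, which makes the constant independent of
  both \<open>x\<close> and \<open>d\<close>. The sign of \<open>d\<close> is free, so that steps to
  the left and to the right are covered.\<close>

lemma Taylor_bound_Icc:
  fixes F :: "nat \<Rightarrow> real \<Rightarrow> real"
  assumes F: "\<And>i x. i \<le> m \<Longrightarrow> x \<in> {a..b} \<Longrightarrow> (F i has_real_derivative F (Suc i) x) (at x within {a..b})"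
    and cont: "continuous_on {a..b} (F (Suc m))"
  obtains B where "B > 0"
    "\<And>x d. x \<in> {a..b} \<Longrightarrow> x + d \<in> {a..b} \<Longrightarrow>
       \<bar>F 0 (x + d) - (\<Sum>i\<le>m. F i x * d ^ i / fact i)\<bar> \<le> B * \<bar>d\<bar> ^ Suc m"
proof -
  obtain B where B: "B > 0" "\<And>x. x \<in> {a..b} \<Longrightarrow> \<bar>F (Suc m) x\<bar> \<le> B"
    using continuous_on_compact_abs_bound[OF compact_Icc cont] by blast
  have "\<bar>F 0 (x + d) - (\<Sum>i\<le>m. F i x * d ^ i / fact i)\<bar> \<le> B / fact m * \<bar>d\<bar> ^ Suc m"
    if "x \<in> {a..b}" "x + d \<in> {a..b}" for x d
    using field_Taylor[OF convex_real_interval(5)[of a b], where f = F and n = m and B = B and w = x and z = "x + d"]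
      F B that by simp
  then show thesis using that[of "B / fact m"] B by simp
qed

text \<open>The even Taylor terms cancel in the difference; what is left beyond \<open>F 1 x\<close>
  is a cubic remainder divided by \<open>2 * d\<close>.\<close>

lemma centered_difference_bound:
  fixes F :: "nat \<Rightarrow> real \<Rightarrow> real"
  assumes F: "\<And>i x. i \<le> 2 \<Longrightarrow> x \<in> {a..b} \<Longrightarrow> (F i has_real_derivative F (Suc i) x) (at x within {a..b})"
    and cont: "continuous_on {a..b} (F 3)"
  obtains B where "B > 0"
    "\<And>x d. x - d \<in> {a..b} \<Longrightarrow> x + d \<in> {a..b} \<Longrightarrow> d > 0 \<Longrightarrow>
       \<bar>(F 0 (x + d) - F 0 (x - d)) / (2 * d) - F 1 x\<bar> \<le> B * d\<^sup>2"
proof -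
  obtain B where B: "B > 0" "\<And>x d. x \<in> {a..b} \<Longrightarrow> x + d \<in> {a..b} \<Longrightarrow>
       \<bar>F 0 (x + d) - (\<Sum>i\<le>2. F i x * d ^ i / fact i)\<bar> \<le> B * \<bar>d\<bar> ^ 3"
    using Taylor_bound_Icc[of 2 a b F] F cont by (auto simp: numeral_3_eq_3)
  have "\<bar>(F 0 (x + d) - F 0 (x - d)) / (2 * d) - F 1 x\<bar> \<le> B * d\<^sup>2"
    if "x - d \<in> {a..b}" "x + d \<in> {a..b}" "d > 0" for x d
  proof -
    have "\<bar>F 0 (x + d) - (F 0 x + F 1 x * d + F 2 x * d\<^sup>2 / 2)\<bar> \<le> B * d ^ 3"
      "\<bar>F 0 (x - d) - (F 0 x - F 1 x * d + F 2 x * d\<^sup>2 / 2)\<bar> \<le> B * d ^ 3"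
      using B(2)[of x d] B(2)[of x "-d"] that by (auto simp: eval_nat_numeral)
    then have "\<bar>F 0 (x + d) - F 0 (x - d) - 2 * d * F 1 x\<bar> \<le> 2 * d * (B * d\<^sup>2)"
      by (simp add: power2_eq_square power3_eq_cube abs_le_iff algebra_simps)
    moreover have "F 0 (x + d) - F 0 (x - d) - 2 * d * F 1 x
        = 2 * d * ((F 0 (x + d) - F 0 (x - d)) / (2 * d) - F 1 x)"
      using that by (simp add: field_simps)
    ultimately show ?thesis using that by (simp add: abs_mult)
  qed
  with B(1) show thesis by (rule that)
qed

text \<open>The weights 4, -1, -3 annihilate both the constant and the quadratic Taylor term. A
  negative \<open>d\<close> gives the mirrored quotient for the right wall.\<close>

lemma one_sided_difference_bound:
  fixes F :: "nat \<Rightarrow> real \<Rightarrow> real"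
  assumes F: "\<And>i x. i \<le> 2 \<Longrightarrow> x \<in> {a..b} \<Longrightarrow> (F i has_real_derivative F (Suc i) x) (at x within {a..b})"
    and cont: "continuous_on {a..b} (F 3)"
  obtains B where "B > 0"
    "\<And>x d. x \<in> {a..b} \<Longrightarrow> x + 2 * d \<in> {a..b} \<Longrightarrow> d \<noteq> 0 \<Longrightarrow>
       \<bar>(4 * F 0 (x + d) - F 0 (x + 2 * d) - 3 * F 0 x) / (2 * d) - F 1 x\<bar> \<le> B * d\<^sup>2"
proof -
  obtain B where B: "B > 0" "\<And>x d. x \<in> {a..b} \<Longrightarrow> x + d \<in> {a..b} \<Longrightarrow>
       \<bar>F 0 (x + d) - (\<Sum>i\<le>2. F i x * d ^ i / fact i)\<bar> \<le> B * \<bar>d\<bar> ^ 3"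
    using Taylor_bound_Icc[of 2 a b F] F cont by (auto simp: numeral_3_eq_3)
  \<comment> \<open>The remainders at \<open>d\<close> and \<open>2 * d\<close> add up to 4 + 8 = 12
    times \<open>B * \<bar>d\<bar> ^ 3\<close>; dividing by \<open>2 * \<bar>d\<bar>\<close> leaves
    the factor 6.\<close>
  have "\<bar>(4 * F 0 (x + d) - F 0 (x + 2 * d) - 3 * F 0 x) / (2 * d) - F 1 x\<bar> \<le> 6 * B * d\<^sup>2"
    if "x \<in> {a..b}" "x + 2 * d \<in> {a..b}" "d \<noteq> 0" for x d
  proof -
    have "x + d \<in> {a..b}" using that by auto
    then have "\<bar>F 0 (x + d) - (F 0 x + F 1 x * d + F 2 x * d\<^sup>2 / 2)\<bar> \<le> B * \<bar>d\<bar> ^ 3"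
      "\<bar>F 0 (x + 2 * d) - (F 0 x + F 1 x * (2 * d) + F 2 x * (2 * d)\<^sup>2 / 2)\<bar> \<le> B * \<bar>2 * d\<bar> ^ 3"
      using B(2)[of x d] B(2)[of x "2 * d"] that by (auto simp: eval_nat_numeral)
    then have "\<bar>4 * F 0 (x + d) - F 0 (x + 2 * d) - 3 * F 0 x - 2 * d * F 1 x\<bar> \<le> 12 * (B * \<bar>d\<bar> ^ 3)"
      by (simp add: abs_mult power_mult_distrib abs_le_iff algebra_simps)
    also have "\<bar>d\<bar> ^ 3 = \<bar>d\<bar> * d\<^sup>2" by (simp add: power3_eq_cube power2_eq_square abs_mult_self_eq mult.assoc)
    also have "12 * (B * (\<bar>d\<bar> * d\<^sup>2)) = \<bar>2 * d\<bar> * (6 * B * d\<^sup>2)" by (simp add: abs_mult)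
    finally have "\<bar>4 * F 0 (x + d) - F 0 (x + 2 * d) - 3 * F 0 x - 2 * d * F 1 x\<bar> \<le> \<bar>2 * d\<bar> * (6 * B * d\<^sup>2)" .
    moreover have "4 * F 0 (x + d) - F 0 (x + 2 * d) - 3 * F 0 x - 2 * d * F 1 x
        = 2 * d * ((4 * F 0 (x + d) - F 0 (x + 2 * d) - 3 * F 0 x) / (2 * d) - F 1 x)"
      using that by (simp add: field_simps)
    ultimately have "\<bar>2 * d\<bar> * \<bar>(4 * F 0 (x + d) - F 0 (x + 2 * d) - 3 * F 0 x) / (2 * d) - F 1 x\<bar>
        \<le> \<bar>2 * d\<bar> * (6 * B * d\<^sup>2)"
      by (simp only: abs_mult)
    then show ?thesis by (rule mult_left_le_imp_le) (use that in simp)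
  qed
  with B(1) that[of "6 * B"] show thesis by simp
qed

text \<open>The odd Taylor terms cancel in the sum. Dividing by \<open>d\<^sup>2\<close> costs two
  orders, so the expansion has to run up to a remainder of order four.\<close>

lemma second_difference_bound:
  fixes F :: "nat \<Rightarrow> real \<Rightarrow> real"
  assumes F: "\<And>i x. i \<le> 3 \<Longrightarrow> x \<in> {a..b} \<Longrightarrow> (F i has_real_derivative F (Suc i) x) (at x within {a..b})"
    and cont: "continuous_on {a..b} (F 4)"
  obtains B where "B > 0"
    "\<And>x d. x - d \<in> {a..b} \<Longrightarrow> x + d \<in> {a..b} \<Longrightarrow> d > 0 \<Longrightarrow>
       \<bar>(F 0 (x + d) - 2 * F 0 x + F 0 (x - d)) / d\<^sup>2 - F 2 x\<bar> \<le> B * d\<^sup>2"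
proof -
  obtain B where B: "B > 0" "\<And>x d. x \<in> {a..b} \<Longrightarrow> x + d \<in> {a..b} \<Longrightarrow>
       \<bar>F 0 (x + d) - (\<Sum>i\<le>3. F i x * d ^ i / fact i)\<bar> \<le> B * \<bar>d\<bar> ^ 4"
    using Taylor_bound_Icc[of 3 a b F] F cont by auto
  have "\<bar>(F 0 (x + d) - 2 * F 0 x + F 0 (x - d)) / d\<^sup>2 - F 2 x\<bar> \<le> 2 * B * d\<^sup>2"
    if "x - d \<in> {a..b}" "x + d \<in> {a..b}" "d > 0" for x d
  proof -
    have "\<bar>F 0 (x + d) - (F 0 x + F 1 x * d + F 2 x * d\<^sup>2 / 2 + F 3 x * d ^ 3 / 6)\<bar> \<le> B * d ^ 4"
      "\<bar>F 0 (x - d) - (F 0 x - F 1 x * d + F 2 x * d\<^sup>2 / 2 - F 3 x * d ^ 3 / 6)\<bar> \<le> B * d ^ 4"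
      using B(2)[of x d] B(2)[of x "-d"] that by (auto simp: eval_nat_numeral)
    then have "\<bar>F 0 (x + d) - 2 * F 0 x + F 0 (x - d) - d\<^sup>2 * F 2 x\<bar> \<le> d\<^sup>2 * (2 * B * d\<^sup>2)"
      by (simp add: power2_eq_square power4_eq_xxxx abs_le_iff algebra_simps)
    moreover have "F 0 (x + d) - 2 * F 0 x + F 0 (x - d) - d\<^sup>2 * F 2 x
        = d\<^sup>2 * ((F 0 (x + d) - 2 * F 0 x + F 0 (x - d)) / d\<^sup>2 - F 2 x)"
      using that by (simp add: field_simps)
    ultimately show ?thesis using that by (simp add: abs_mult)
  qed
  with B(1) that[of "2 * B"] show thesis by simp
qed

section \<open>Remainders of the exponential and of an Euler step in time\<close>

lemma abs_exp_sub_linear_le: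
  fixes y :: real
  assumes "\<bar>y\<bar> \<le> 1"
  shows "\<bar>exp y - 1 - y\<bar> \<le> y\<^sup>2"
proof -
  have "exp y \<le> 1 + y + y\<^sup>2"
  proof (cases "y \<ge> 0")
    case True
    then show ?thesis using exp_bound assms by simp
  next
    case False
    \<comment> \<open>The product below telescopes to \<open>1 - y ^ 3\<close>, which is at least 1
      for negative \<open>y\<close>; replacing \<open>1 - y\<close> by the larger
      \<open>exp (- y)\<close> then gives the claim.\<close>
    then have "y ^ 3 \<le> 0" by simp
    then have "1 \<le> (1 + y + y\<^sup>2) * (1 - y)"
      by (simp add: algebra_simps power2_eq_square power3_eq_cube)
    also have "\<dots> \<le> (1 + y + y\<^sup>2) * exp (- y)"
      using exp_ge_add_one_self[of "-y"] assms by (intro mult_left_mono) auto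
    finally show ?thesis by (simp add: exp_minus field_simps)
  qed
  then show ?thesis using exp_ge_add_one_self[of y] zero_le_power2[of y] unfolding abs_le_iff by linarith
qed

lemma Euler_bound_Icc:
  assumes "Ck_on k {0..T} g" "k \<ge> 2" "T > 0"
    and "(g has_real_derivative g') (at 0 within {0..T})"
  obtains B where "B > 0" "\<And>t. t \<in> {0..T} \<Longrightarrow> \<bar>g t - g 0 - t * g'\<bar> \<le> B * t\<^sup>2"
proof -
  obtain G where G0: "G 0 = g" and cont: "\<forall>j\<le>k. continuous_on {0..T} (G j)"
    and G: "\<forall>j<k. \<forall>p I. (\<forall>s\<in>I. p + s *\<^sub>R 1 \<in> {0..T}) \<longrightarrow>
       (\<forall>s\<in>I. ((\<lambda>s. G j (p + s *\<^sub>R 1)) has_real_derivative G (Suc j) (p + s *\<^sub>R 1)) (at s within I))"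
    using Ck_on_directional[OF assms(1), of 1] by blast
  have G': "(G j has_real_derivative G (Suc j) s) (at s within {0..T})" if "j < k" "s \<in> {0..T}" for j s
    using G[rule_format, of j "{0..T}" 0 s] that by simp
  obtain B where B: "B > 0" "\<And>x d. x \<in> {0..T} \<Longrightarrow> x + d \<in> {0..T} \<Longrightarrow>
       \<bar>G 0 (x + d) - (\<Sum>i\<le>1. G i x * d ^ i / fact i)\<bar> \<le> B * \<bar>d\<bar> ^ Suc 1"
    using Taylor_bound_Icc[of 1 0 T G] G' cont assms(2) by auto
  \<comment> \<open>\<open>G\<close> comes from \<open>Ck_on\<close> and \<open>g'\<close> from the
    differential equation. Derivatives within a nondegenerate interval are unique, so the two agree
    at the endpoint 0.\<close>
  have "G 1 0 = g'"
    using G'[of 0 0] assms G0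
    by (auto intro!: vector_derivative_unique_within_closed_interval[of 0 T 0 g] simp: has_real_derivative_iff_has_vector_derivative)
  then show thesis using that[OF B(1)] B(2)[of 0] assms(3) by (auto simp: G0 algebra_simps power2_eq_square)
qed

text \<open>Differentiating along \<open>(0, 1)\<close> at a frozen time yields the space
  derivatives that the difference quotient lemmas take as input.\<close>

lemma Ck_on_slice_derivatives:
  fixes g :: "real \<Rightarrow> real \<Rightarrow> real"
  assumes "Ck_on k ({0..T} \<times> {0..1}) (\<lambda>(t, x). g t x)" "t \<in> {0..T}"
  obtains G :: "nat \<Rightarrow> real \<Rightarrow> real" where "G 0 = g t"
    "\<And>i x. i < k \<Longrightarrow> x \<in> {0..1} \<Longrightarrow> (G i has_real_derivative G (Suc i) x) (at x within {0..1})"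
    "\<And>i. i \<le> k \<Longrightarrow> continuous_on {0..1} (G i)"
proof -
  obtain G where G0: "G 0 = (\<lambda>(t, x). g t x)"
    and cont: "\<forall>j\<le>k. continuous_on ({0..T} \<times> {0..1}) (G j)"
    and G: "\<forall>j<k. \<forall>p I. (\<forall>s\<in>I. p + s *\<^sub>R (0, 1) \<in> {0..T} \<times> {0..1}) \<longrightarrow>
       (\<forall>s\<in>I. ((\<lambda>s. G j (p + s *\<^sub>R (0, 1))) has_real_derivative G (Suc j) (p + s *\<^sub>R (0, 1))) (at s within I))"
    using Ck_on_directional[OF assms(1), of "(0, 1)"] by blast
  show thesis
  proof (rule that[of "\<lambda>i x. G i (t, x)"])
    show "(\<lambda>x. G 0 (t, x)) = g t" by (simp add: G0)
    show "((\<lambda>x. G i (t, x)) has_real_derivative G (Suc i) (t, x)) (at x within {0..1})"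
      if "i < k" "x \<in> {0..1}" for i x
      using G[rule_format, of i "{0..1}" "(t, 0)" x] that assms(2) by simp
    show "continuous_on {0..1} (\<lambda>x. G i (t, x))" if "i \<le> k" for i
      using assms(2) that cont
      by (intro continuous_on_compose2[of "{0..T} \<times> {0..1}" "G i" "{0..1}" "Pair t"])
         (auto intro!: continuous_intros)
  qed
qed

text \<open>The second time derivative is bounded on the whole compact rectangle rather than slice
  by slice, so that \<open>B\<close> does not depend on \<open>x\<close>.\<close>

lemma Euler_bound_slices:
  fixes g :: "real \<Rightarrow> real \<Rightarrow> real"
  assumes "Ck_on k ({0..T} \<times> {0..1}) (\<lambda>(t, x). g t x)" "k \<ge> 2" "T > 0"
  obtains g' B where "B > 0"
    "\<And>x. x \<in> {0..1} \<Longrightarrow> ((\<lambda>s. g s x) has_real_derivative g' x) (at 0 within {0..T})"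
    "\<And>t x. t \<in> {0..T} \<Longrightarrow> x \<in> {0..1} \<Longrightarrow> \<bar>g t x - g 0 x - t * g' x\<bar> \<le> B * t\<^sup>2"
proof -
  obtain G where G0: "G 0 = (\<lambda>(t, x). g t x)"
    and cont: "\<forall>j\<le>k. continuous_on ({0..T} \<times> {0..1}) (G j)"
    and G: "\<forall>j<k. \<forall>p I. (\<forall>s\<in>I. p + s *\<^sub>R (1, 0) \<in> {0..T} \<times> {0..1}) \<longrightarrow>
       (\<forall>s\<in>I. ((\<lambda>s. G j (p + s *\<^sub>R (1, 0))) has_real_derivative G (Suc j) (p + s *\<^sub>R (1, 0))) (at s within I))"
    using Ck_on_directional[OF assms(1), of "(1, 0)"] by blast
  have G': "((\<lambda>s. G j (s, x)) has_real_derivative G (Suc j) (s, x)) (at s within {0..T})"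
    if "j < k" "s \<in> {0..T}" "x \<in> {0..1}" for j s x
    using G[rule_format, of j "{0..T}" "(0, x)" s] that by simp
  have cont2: "continuous_on ({0..T} \<times> {0..1}) (G 2)" using cont assms(2) by simp
  have "compact ({0..T} \<times> {0..1::real})" by (intro compact_Times compact_Icc)
  from continuous_on_compact_abs_bound[OF this cont2]
  obtain B where B: "B > 0" "\<And>p. p \<in> {0..T} \<times> {0..1} \<Longrightarrow> \<bar>G 2 p\<bar> \<le> B" by metis
  show thesis
  proof (rule that[OF B(1)])
    show "((\<lambda>s. g s x) has_real_derivative G 1 (0, x)) (at 0 within {0..T})" if "x \<in> {0..1}" for x
      using G'[of 0 0 x] that assms by (simp add: G0)
    show "\<bar>g t x - g 0 x - t * G 1 (0, x)\<bar> \<le> B * t\<^sup>2" if "t \<in> {0..T}" "x \<in> {0..1}" for t x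
      using field_Taylor[OF convex_real_interval(5)[of 0 T], where f = "\<lambda>i s. G i (s, x)" and n = 1
          and B = B and w = 0 and z = t] G' B(2) that assms(2)
      by (simp add: G0 algebra_simps power2_eq_square numeral_2_eq_2)
  qed
qed

section \<open>Pointwise time derivatives from the differential equations\<close>

lemma pd_t_eq:
  assumes "T > 0" "t \<in> {0..T}" "((\<lambda>s. g s x) has_real_derivative g') (at t within {0..T})"
  shows "pd_t T g t x = g'"
  unfolding pd_t_def using assms
  by (intro vector_derivative_within_closed_interval)
     (auto simp: has_real_derivative_iff_has_vector_derivative)

lemma pd_x_eq:
  assumes "x \<in> {0..1}" "(g t has_real_derivative g') (at x within {0..1})"
  shows "pd_x g t x = g'"
  unfolding pd_x_def using assms
  by (intro vector_derivative_within_closed_interval)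
     (auto simp: has_real_derivative_iff_has_vector_derivative)

text \<open>Dividing the momentum equation by \<open>h\<close> and using mass conservation gives the
  non-conservative form that the scheme discretises.\<close>

lemma time_derivatives_of_solution:
  fixes H V :: "nat \<Rightarrow> real \<Rightarrow> real"
  assumes T: "T > 0" "t \<in> {0..T}" and x: "x \<in> {0..1}"
    and H0: "H 0 = h t" and V0: "V 0 = v t"
    and H: "\<And>i x. i < 2 \<Longrightarrow> x \<in> {0..1} \<Longrightarrow> (H i has_real_derivative H (Suc i) x) (at x within {0..1})"
    and V: "\<And>i x. i < 2 \<Longrightarrow> x \<in> {0..1} \<Longrightarrow> (V i has_real_derivative V (Suc i) x) (at x within {0..1})"
    and ht: "((\<lambda>s. h s x) has_real_derivative ht) (at t within {0..T})"
    and vt: "((\<lambda>s. v s x) has_real_derivative vt) (at t within {0..T})"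
    and pos: "h t x > 0"
    and mass: "pd_t T h t x + pd_x (\<lambda>t x. h t x * v t x) t x = 0"
    and mom: "pd_t T (\<lambda>t x. h t x * v t x) t x
             + pd_x (\<lambda>t x. h t x * (v t x)\<^sup>2 + 1/2 * (h t x)\<^sup>2) t x
           = \<mu> * pd_x (\<lambda>t x. h t x * pd_x v t x) t x + h t x * f"
  shows "ht = - (H 1 x * V 0 x + H 0 x * V 1 x)"
    and "vt = \<mu> * (V 2 x + V 1 x * (H 1 x / H 0 x)) - V 0 x * V 1 x - H 1 x + f"
proof -
  have hx: "(h t has_real_derivative H 1 y) (at y within {0..1})"
    and vx: "(v t has_real_derivative V 1 y) (at y within {0..1})"
    and vxx: "(V 1 has_real_derivative V 2 y) (at y within {0..1})" if "y \<in> {0..1}" for y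
    using H[of 0 y] V[of 0 y] V[of 1 y] H0 V0 that by (auto simp: numeral_2_eq_2)
  have pvx: "pd_x v t y = V 1 y" if "y \<in> {0..1}" for y
    using that vx[OF that] by (rule pd_x_eq)
  have pt: "pd_t T h t x = ht" using T ht by (rule pd_t_eq)
  have px: "pd_x (\<lambda>t x. h t x * v t x) t x = H 1 x * v t x + h t x * V 1 x"
    using x by (intro pd_x_eq) (auto intro!: derivative_eq_intros hx vx)
  show eq: "ht = - (H 1 x * V 0 x + H 0 x * V 1 x)" using mass pt px H0 V0 by simp
  have "pd_t T (\<lambda>t x. h t x * v t x) t x = ht * v t x + h t x * vt"
    using T by (intro pd_t_eq) (auto intro!: derivative_eq_intros ht vt)
  moreover have "pd_x (\<lambda>t x. h t x * (v t x)\<^sup>2 + 1/2 * (h t x)\<^sup>2) t x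
      = H 1 x * (v t x)\<^sup>2 + 2 * h t x * v t x * V 1 x + h t x * H 1 x"
    using x by (intro pd_x_eq) (auto intro!: derivative_eq_intros hx vx)
  \<comment> \<open>The inner \<open>pd_x v\<close> is identified with \<open>V 1\<close> only on
    the unit interval, so the exchange is made by a transformation within that interval.\<close>
  moreover have "pd_x (\<lambda>t x. h t x * pd_x v t x) t x = H 1 x * V 1 x + h t x * V 2 x"
  proof (intro pd_x_eq x)
    have "((\<lambda>y. h t y * V 1 y) has_vector_derivative H 1 x * V 1 x + h t x * V 2 x) (at x within {0..1})"
      unfolding has_real_derivative_iff_has_vector_derivative[symmetric]
      using x by (auto intro!: derivative_eq_intros hx vxx simp del: One_nat_def)
    then show "((\<lambda>y. h t y * pd_x v t y) has_real_derivative H 1 x * V 1 x + h t x * V 2 x) (at x within {0..1})"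
      unfolding has_real_derivative_iff_has_vector_derivative
      by (rule has_vector_derivative_transform[OF x, rotated]) (simp add: pvx)
  qed
  ultimately have "ht * v t x + h t x * vt + (H 1 x * (v t x)\<^sup>2 + 2 * h t x * v t x * V 1 x + h t x * H 1 x)
      = \<mu> * (H 1 x * V 1 x + h t x * V 2 x) + h t x * f"
    using mom by simp
  \<comment> \<open>Inserting mass conservation, \<open>ht * v t x\<close> cancels the term with
    \<open>(v t x)\<^sup>2\<close> and one of the two copies of
    \<open>h t x * v t x * V 1 x\<close>.\<close>
  then have "h t x * vt = h t x * (\<mu> * V 2 x - v t x * V 1 x - H 1 x + f) + \<mu> * (H 1 x * V 1 x)"
    unfolding eq H0 V0 by (simp add: algebra_simps power2_eq_square)
  then show "vt = \<mu> * (V 2 x + V 1 x * (H 1 x / H 0 x)) - V 0 x * V 1 x - H 1 x + f"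
    using pos unfolding H0 V0 by (simp add: field_simps)
qed

section \<open>One-step errors of \<open>h\<close> and \<open>v\<close>\<close>

text \<open>The logarithm of the ratio is a difference of logarithms, so this is the centered
  quotient of \<open>ln (H 0 x)\<close>, whose derivative is \<open>H 1 x / H 0 x\<close>.
  Positivity makes the logarithm as smooth as \<open>H 0\<close>.\<close>

lemma ln_centered_difference_bound:
  fixes H :: "nat \<Rightarrow> real \<Rightarrow> real"
  assumes H: "\<And>i x. i \<le> 2 \<Longrightarrow> x \<in> {a..b} \<Longrightarrow> (H i has_real_derivative H (Suc i) x) (at x within {a..b})"
    and cont: "\<And>i. i \<le> 3 \<Longrightarrow> continuous_on {a..b} (H i)"
    and pos: "\<And>x. x \<in> {a..b} \<Longrightarrow> H 0 x > 0"
  obtains B where "B > 0"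
    "\<And>x d. x - d \<in> {a..b} \<Longrightarrow> x + d \<in> {a..b} \<Longrightarrow> d > 0 \<Longrightarrow>
       \<bar>ln (H 0 (x + d) / H 0 (x - d)) / (2 * d) - H 1 x / H 0 x\<bar> \<le> B * d\<^sup>2"
proof -
  \<comment> \<open>The list holds \<open>ln (H 0 x)\<close> and its first three derivatives;
    indexing turns it into the kind of sequence that \<open>centered_difference_bound\<close>
    expects, where only indices up to 3 occur.\<close>
  define L :: "nat \<Rightarrow> real \<Rightarrow> real" where "L i = (\<lambda>x. [ln (H 0 x), H 1 x / H 0 x, H 2 x / H 0 x - (H 1 x / H 0 x)\<^sup>2,
     H 3 x / H 0 x - 3 * H 1 x * H 2 x / (H 0 x)\<^sup>2 + 2 * (H 1 x / H 0 x) ^ 3] ! i)" for i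
  have H': "(H 0 has_real_derivative H 1 x) (at x within {a..b})"
    "(H 1 has_real_derivative H 2 x) (at x within {a..b})"
    "(H 2 has_real_derivative H 3 x) (at x within {a..b})" if "x \<in> {a..b}" for x
    using H[of 0 x] H[of 1 x] H[of 2 x] that by (auto simp: numeral_2_eq_2 numeral_3_eq_3)
  have pos': "H 0 x \<noteq> 0" if "x \<in> {a..b}" for x using pos[OF that] by simp
  have LD: "(L i has_real_derivative L (Suc i) x) (at x within {a..b})" if "i \<le> 2" "x \<in> {a..b}" for i x
  proof -
    have "i = 0 \<or> i = 1 \<or> i = 2" using that by auto
    then show ?thesis
    proof (elim disjE)
      show ?thesis if "i = 0" unfolding that L_def
        using pos[OF \<open>x \<in> _\<close>] by (auto intro!: derivative_eq_intros H'(1) \<open>x \<in> _\<close> simp: field_simps)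
      show ?thesis if "i = 1" unfolding that L_def
        using pos[OF \<open>x \<in> _\<close>]
        by (auto intro!: derivative_eq_intros H' \<open>x \<in> _\<close> simp: numeral_2_eq_2[symmetric] simp del: One_nat_def)
           (simp add: field_simps power2_eq_square)
      show ?thesis if "i = 2" unfolding that L_def
        using pos[OF \<open>x \<in> _\<close>]
        by (auto intro!: derivative_eq_intros H' \<open>x \<in> _\<close> simp: numeral_2_eq_2[symmetric] numeral_3_eq_3[symmetric] simp del: One_nat_def)
           (simp add: field_simps power2_eq_square power3_eq_cube)
    qed
  qed
  have "continuous_on {a..b} (L 3)"
    unfolding L_def using pos' by (auto intro!: continuous_intros cont simp: numeral_3_eq_3[symmetric])
  with LD obtain B where B: "B > 0"
    "\<And>x d. x - d \<in> {a..b} \<Longrightarrow> x + d \<in> {a..b} \<Longrightarrow> d > 0 \<Longrightarrow>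
       \<bar>(L 0 (x + d) - L 0 (x - d)) / (2 * d) - L 1 x\<bar> \<le> B * d\<^sup>2"
    using centered_difference_bound[of a b L] by blast
  have "\<bar>ln (H 0 (x + d) / H 0 (x - d)) / (2 * d) - H 1 x / H 0 x\<bar> \<le> B * d\<^sup>2"
    if "x - d \<in> {a..b}" "x + d \<in> {a..b}" "d > 0" for x d
    using B(2)[OF that] ln_divide_pos[OF pos[OF that(2)] pos[OF that(1)]] by (simp add: L_def)
  with B(1) show thesis by (rule that)
qed

text \<open>All three formulas for \<open>h\<close> have the shape \<open>y * exp (dt * a)\<close>.
  Here \<open>r\<close> is the exact logarithmic rate, \<open>a\<close> its discretisation,
  \<open>e\<close> stands for the squared space step and \<open>Y\<close> for the exact value after
  the step.\<close>

lemma exp_step_bound: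
  fixes a r :: real
  assumes "\<bar>y\<bar> \<le> C" "\<bar>a\<bar> \<le> A" "dt * A \<le> 1" "\<bar>a - r\<bar> \<le> D * e" "\<bar>Y - y - dt * (y * r)\<bar> \<le> B * dt\<^sup>2"
    and "dt > 0"
  shows "\<bar>y * exp (dt * a) - Y\<bar> \<le> dt * ((C * A\<^sup>2 + B) * dt + C * D * e)"
proof -
  have C: "C \<ge> 0" using assms(1) by linarith
  have "\<bar>dt * a\<bar> \<le> dt * A" using assms(2,6) by (simp add: abs_mult)
  then have "\<bar>exp (dt * a) - 1 - dt * a\<bar> \<le> (dt * a)\<^sup>2"
    using assms(3) by (intro abs_exp_sub_linear_le) linarith
  also have "\<dots> \<le> (dt * A)\<^sup>2"
    using \<open>\<bar>dt * a\<bar> \<le> dt * A\<close> by (metis abs_ge_zero power2_abs power_mono)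
  finally have "\<bar>y\<bar> * \<bar>exp (dt * a) - 1 - dt * a\<bar> \<le> C * (dt * A)\<^sup>2"
    using assms(1) C by (intro mult_mono) auto
  then have 1: "\<bar>y * (exp (dt * a) - 1 - dt * a)\<bar> \<le> C * (dt * A)\<^sup>2" by (simp only: abs_mult)
  have "\<bar>y\<bar> * \<bar>a - r\<bar> \<le> C * (D * e)"
    using assms(1,4) C by (intro mult_mono) auto
  then have 2: "\<bar>dt * (y * (a - r))\<bar> \<le> dt * (C * (D * e))"
    using assms(6) by (simp add: abs_mult)
  \<comment> \<open>Three sources of error: linearising the exponential, replacing \<open>r\<close>
    by \<open>a\<close>, and the Euler defect of \<open>Y\<close>.\<close>
  have "y * exp (dt * a) - Y = y * (exp (dt * a) - 1 - dt * a) + dt * (y * (a - r)) - (Y - y - dt * (y * r))"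
    by (simp add: algebra_simps)
  then have "\<bar>y * exp (dt * a) - Y\<bar> \<le> C * (dt * A)\<^sup>2 + dt * (C * (D * e)) + B * dt\<^sup>2"
    using 1 2 assms(5) by linarith
  then show ?thesis by (simp add: algebra_simps power2_eq_square)
qed

text \<open>Each formula is brought to the form \<open>H 0 x * exp (dt * a)\<close> with
  \<open>a\<close> close to the exact rate, after which \<open>exp_step_bound\<close> applies. The
  threshold on \<open>dt\<close> keeps the exponent in the range where the exponential may be
  linearised.\<close>

lemma step_h_error:
  fixes H V :: "nat \<Rightarrow> real \<Rightarrow> real"
  assumes H0: "H 0 = h 0" and V0: "V 0 = v 0"
    and H: "\<And>i x. i < 3 \<Longrightarrow> x \<in> {0..1} \<Longrightarrow> (H i has_real_derivative H (Suc i) x) (at x within {0..1})"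
    and V: "\<And>i x. i < 3 \<Longrightarrow> x \<in> {0..1} \<Longrightarrow> (V i has_real_derivative V (Suc i) x) (at x within {0..1})"
    and contH: "\<And>i. i \<le> 3 \<Longrightarrow> continuous_on {0..1} (H i)"
    and contV: "\<And>i. i \<le> 3 \<Longrightarrow> continuous_on {0..1} (V i)"
    and pos: "\<And>x. x \<in> {0..1} \<Longrightarrow> h 0 x > 0"
    and bdry: "v 0 0 = 0" "v 0 1 = 0"
    and Euler: "\<And>t x. t \<in> {0..T} \<Longrightarrow> x \<in> {0..1} \<Longrightarrow>
       \<bar>h t x - h 0 x + t * (H 1 x * V 0 x + H 0 x * V 1 x)\<bar> \<le> B * t\<^sup>2"
  obtains M \<epsilon> where "M > 0" "\<epsilon> > 0"
    "\<And>dt n i. 0 < dt \<Longrightarrow> dt < T \<Longrightarrow> dt < \<epsilon> \<Longrightarrow> n \<ge> 2 \<Longrightarrow> i \<le> n \<Longrightarrow>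
       \<bar>step_h dt (1 / real n) n (\<lambda>i. h 0 (real i * (1 / real n))) (\<lambda>i. v 0 (real i * (1 / real n))) i
          - h dt (real i * (1 / real n))\<bar> \<le> M * dt * (dt + (1 / real n)\<^sup>2)"
proof -
  have H0pos: "\<And>x. x \<in> {0..1} \<Longrightarrow> H 0 x > 0" using pos H0 by simp
  obtain Bv where Bv: "Bv > 0" "\<And>x d. x - d \<in> {0..1} \<Longrightarrow> x + d \<in> {0..1} \<Longrightarrow> d > 0 \<Longrightarrow>
       \<bar>(V 0 (x + d) - V 0 (x - d)) / (2 * d) - V 1 x\<bar> \<le> Bv * d\<^sup>2"
    using centered_difference_bound[of 0 1 V] V contV by auto
  obtain Bs where Bs: "Bs > 0" "\<And>x d. x \<in> {0..1} \<Longrightarrow> x + 2 * d \<in> {0..1} \<Longrightarrow> d \<noteq> 0 \<Longrightarrow>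
       \<bar>(4 * V 0 (x + d) - V 0 (x + 2 * d) - 3 * V 0 x) / (2 * d) - V 1 x\<bar> \<le> Bs * d\<^sup>2"
    using one_sided_difference_bound[of 0 1 V] V contV by auto
  obtain Bl where Bl: "Bl > 0" "\<And>x d. x - d \<in> {0..1} \<Longrightarrow> x + d \<in> {0..1} \<Longrightarrow> d > 0 \<Longrightarrow>
       \<bar>ln (H 0 (x + d) / H 0 (x - d)) / (2 * d) - H 1 x / H 0 x\<bar> \<le> Bl * d\<^sup>2"
    using ln_centered_difference_bound[of 0 1 H] H contH H0pos by auto
  obtain C where C: "C > 0" "\<And>x. x \<in> {0..1} \<Longrightarrow> \<bar>H 0 x\<bar> \<le> C"
    using continuous_on_compact_abs_bound[OF compact_Icc contH[of 0]] by auto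
  obtain K where K: "K > 0" "\<And>x. x \<in> {0..1} \<Longrightarrow> \<bar>V 0 x\<bar> \<le> K"
    using continuous_on_compact_abs_bound[OF compact_Icc contV[of 0]] by auto
  \<comment> \<open>The exact initial rate of \<open>ln h\<close>: multiplied by
    \<open>H 0 x\<close> it becomes the rate that appears in \<open>Euler\<close>.\<close>
  define r where "r x = - (V 1 x + V 0 x * (H 1 x / H 0 x))" for x
  have "continuous_on {0..1} r"
    unfolding r_def using H0pos by (force intro!: continuous_intros contH contV)
  then obtain A0 where A0: "A0 > 0" "\<And>x. x \<in> {0..1} \<Longrightarrow> \<bar>r x\<bar> \<le> A0"
    using continuous_on_compact_abs_bound[OF compact_Icc] by blast
  \<comment> \<open>\<open>Bs\<close> serves the walls, \<open>Bv\<close> and \<open>K * Bl\<close>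
    the interior, so the sum fits every branch. As the space step is at most 1, \<open>A\<close>
    then bounds all discrete rates.\<close>
  define D where "D = Bs + Bv + K * Bl"
  define A where "A = A0 + D"
  \<comment> \<open>The sign of \<open>B\<close> is left open, hence the absolute value in a
    constant that has to be positive.\<close>
  define M where "M = C * A\<^sup>2 + \<bar>B\<bar> + C * D"
  have D: "D > 0" unfolding D_def using Bs Bv Bl K by (simp add: add_pos_pos)
  have A: "A > 0" unfolding A_def using A0 D by simp
  have "\<bar>step_h dt (1 / real n) n (\<lambda>i. h 0 (real i * (1 / real n))) (\<lambda>i. v 0 (real i * (1 / real n))) i
          - h dt (real i * (1 / real n))\<bar> \<le> M * dt * (dt + (1 / real n)\<^sup>2)"
    if dt: "0 < dt" "dt < T" "dt < 1 / A" and n: "n \<ge> 2" and i: "i \<le> n" for dt n i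
  proof -
    define dx where "dx = 1 / real n"
    define x where "x = real i * dx"
    have dx: "dx > 0" "real n * dx = 1" using n by (auto simp: dx_def)
    have x: "x \<in> {0..1}" using i n unfolding x_def dx_def by (auto simp: field_simps)
    have "\<exists>a. step_h dt dx n (\<lambda>i. h 0 (real i * dx)) (\<lambda>i. v 0 (real i * dx)) i = H 0 x * exp (dt * a)
        \<and> \<bar>a - r x\<bar> \<le> D * dx\<^sup>2"
    proof -
      consider "i = 0" | "i = n" | "0 < i" "i < n" using i by linarith
      then show ?thesis
      proof cases
        \<comment> \<open>The velocity vanishes at the wall, so the term \<open>3 * V 0 x\<close> of
          the one-sided quotient drops out and \<open>r 0\<close> reduces to \<open>- V 1 0\<close>.
          Having \<open>n \<ge> 2\<close> keeps \<open>2 * dx\<close> inside the interval.\<close>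
        case 1
        have "x = 0" using 1 by (simp add: x_def)
        have "2 * dx \<le> 1" using n by (simp add: dx_def field_simps)
        then have "\<bar>(4 * V 0 dx - V 0 (2 * dx)) / (2 * dx) - V 1 0\<bar> \<le> Bs * dx\<^sup>2"
          using Bs(2)[of 0 dx] dx bdry V0 by simp
        also have "\<dots> \<le> D * dx\<^sup>2" unfolding D_def using Bv Bl K by (intro mult_right_mono) auto
        also have "(4 * V 0 dx - V 0 (2 * dx)) / (2 * dx) - V 1 0
            = - ((V 0 (2 * dx) - 4 * V 0 dx) / (2 * dx) - r 0)"
          using bdry V0 dx by (simp add: r_def field_simps)
        finally show ?thesis using 1 \<open>x = 0\<close> H0 V0
          by (intro exI[of _ "(V 0 (2 * dx) - 4 * V 0 dx) / (2 * dx)"]) (simp add: step_h_def)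
      next
        \<comment> \<open>Mirror image: the one-sided quotient is taken with step
          \<open>- dx\<close>, whose sign accounts for the opposite weights in the scheme.\<close>
        case 2
        have "x = 1" using 2 dx by (simp add: x_def)
        have "2 * dx \<le> 1" using n by (simp add: dx_def field_simps)
        then have "\<bar>(4 * V 0 (1 - dx) - V 0 (1 - 2 * dx)) / (2 * (- dx)) - V 1 1\<bar> \<le> Bs * dx\<^sup>2"
          using Bs(2)[of 1 "- dx"] dx bdry V0 by simp
        also have "\<dots> \<le> D * dx\<^sup>2" unfolding D_def using Bv Bl K by (intro mult_right_mono) auto
        also have "(4 * V 0 (1 - dx) - V 0 (1 - 2 * dx)) / (2 * (- dx)) - V 1 1
            = - ((4 * V 0 (1 - dx) - V 0 (1 - 2 * dx)) / (2 * dx) - r 1)"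
          using bdry V0 dx by (simp add: r_def field_simps)
        finally show ?thesis using 2 \<open>x = 1\<close> H0 V0 n dx
          by (intro exI[of _ "(4 * V 0 (1 - dx) - V 0 (1 - 2 * dx)) / (2 * dx)"])
             (simp add: step_h_def of_nat_diff left_diff_distrib)
      next
        case 3
        have xm: "real (i - 1) * dx = x - dx" and xp: "real (i + 1) * dx = x + dx"
          using 3 by (auto simp: x_def of_nat_diff algebra_simps)
        have "real (i + 1) * dx \<le> real n * dx" using 3 dx by (intro mult_right_mono) auto
        moreover have "0 \<le> real (i - 1) * dx" using dx by simp
        ultimately have xmp: "x - dx \<in> {0..1}" "x + dx \<in> {0..1}"
          unfolding xm xp dx(2) using dx(1) by auto
        define p where "p = (V 0 (x + dx) - V 0 (x - dx)) / (2 * dx)"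
        define l where "l = ln (H 0 (x + dx) / H 0 (x - dx)) / (2 * dx)"
        \<comment> \<open>The scheme has the ratio upside down, which provides the minus sign in
          front of \<open>V 0 x * l\<close>.\<close>
        have ln_eq: "ln (H 0 (x - dx) / H 0 (x + dx)) = - ln (H 0 (x + dx) / H 0 (x - dx))"
          using H0pos[OF xmp(1)] H0pos[OF xmp(2)] by (simp add: ln_divide_pos)
        have "\<bar>V 0 x\<bar> * \<bar>l - H 1 x / H 0 x\<bar> \<le> K * (Bl * dx\<^sup>2)"
          using Bl(2)[OF xmp dx(1)] K x unfolding l_def by (intro mult_mono) auto
        then have "\<bar>V 0 x * (l - H 1 x / H 0 x)\<bar> \<le> K * Bl * dx\<^sup>2"
          by (simp add: abs_mult)
        moreover have "\<bar>p - V 1 x\<bar> \<le> Bv * dx\<^sup>2" using Bv(2)[OF xmp dx(1)] unfolding p_def .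
        moreover have "0 \<le> Bs * dx\<^sup>2" using Bs by simp
        moreover have "- (p + V 0 x * l) - r x = - (p - V 1 x) - V 0 x * (l - H 1 x / H 0 x)"
          by (simp add: r_def algebra_simps)
        ultimately have "\<bar>- (p + V 0 x * l) - r x\<bar> \<le> D * dx\<^sup>2"
          unfolding D_def distrib_right by linarith
        moreover have "step_h dt dx n (\<lambda>i. h 0 (real i * dx)) (\<lambda>i. v 0 (real i * dx)) i
            = H 0 x * exp (dt * (- (p + V 0 x * l)))"
          using 3 dx unfolding step_h_def xm xp x_def[symmetric] H0[symmetric] V0[symmetric] ln_eq p_def l_def
          by (simp add: field_simps)
        ultimately show ?thesis by blast
      qed
    qed
    then obtain a where a: "step_h dt dx n (\<lambda>i. h 0 (real i * dx)) (\<lambda>i. v 0 (real i * dx)) i = H 0 x * exp (dt * a)"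
      "\<bar>a - r x\<bar> \<le> D * dx\<^sup>2" by blast
    have "dx \<le> 1" using n by (simp add: dx_def)
    then have "D * dx\<^sup>2 \<le> D" using D dx by (simp add: power_le_one)
    then have "\<bar>a\<bar> \<le> A" using a(2) A0(2)[OF x] unfolding A_def by linarith
    moreover have "dt * A \<le> 1" using dt A by (simp add: field_simps)
    moreover have "\<bar>h dt x - H 0 x - dt * (H 0 x * r x)\<bar> \<le> \<bar>B\<bar> * dt\<^sup>2"
    proof -
      have "h dt x - H 0 x - dt * (H 0 x * r x) = h dt x - h 0 x + dt * (H 1 x * V 0 x + H 0 x * V 1 x)"
        using H0pos[OF x] H0 by (simp add: r_def field_simps)
      also have "\<bar>\<dots>\<bar> \<le> B * dt\<^sup>2" using Euler[of dt x] dt x by simp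
      also have "\<dots> \<le> \<bar>B\<bar> * dt\<^sup>2" by (intro mult_right_mono) auto
      finally show ?thesis .
    qed
    ultimately have "\<bar>H 0 x * exp (dt * a) - h dt x\<bar> \<le> dt * ((C * A\<^sup>2 + \<bar>B\<bar>) * dt + C * D * dx\<^sup>2)"
      using C(2)[OF x] a(2) dt by (intro exp_step_bound)
    also have "\<dots> \<le> dt * (M * dt + M * dx\<^sup>2)"
    proof -
      have "C * A\<^sup>2 + \<bar>B\<bar> \<le> M" "C * D \<le> M" unfolding M_def using C D by auto
      then show ?thesis using dt by (intro mult_left_mono add_mono mult_right_mono) auto
    qed
    finally show ?thesis
      unfolding a(1)[symmetric] by (simp add: dx_def x_def algebra_simps)
  qed
  moreover have "M > 0" unfolding M_def using C D by (intro add_nonneg_pos) auto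
  ultimately show thesis using that[of M "1 / A"] A by simp
qed

text \<open>In the interior the update is \<open>V 0 x + dt * a\<close> with \<open>a\<close> a
  discretisation of the exact rate, so only the error of \<open>a\<close> and the Euler defect add
  up. No exponential has to be linearised, hence no threshold on \<open>dt\<close>; and a single
  step calls for no relation between \<open>dt\<close> and the space step.\<close>

lemma step_v_error:
  fixes H V :: "nat \<Rightarrow> real \<Rightarrow> real"
  assumes H0: "H 0 = h 0" and V0: "V 0 = v 0"
    and H: "\<And>i x. i < 3 \<Longrightarrow> x \<in> {0..1} \<Longrightarrow> (H i has_real_derivative H (Suc i) x) (at x within {0..1})"
    and V: "\<And>i x. i < 4 \<Longrightarrow> x \<in> {0..1} \<Longrightarrow> (V i has_real_derivative V (Suc i) x) (at x within {0..1})"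
    and contH: "\<And>i. i \<le> 3 \<Longrightarrow> continuous_on {0..1} (H i)"
    and contV: "\<And>i. i \<le> 4 \<Longrightarrow> continuous_on {0..1} (V i)"
    and pos: "\<And>x. x \<in> {0..1} \<Longrightarrow> h 0 x > 0"
    and bdry: "\<And>t. t \<in> {0..T} \<Longrightarrow> v t 0 = 0" "\<And>t. t \<in> {0..T} \<Longrightarrow> v t 1 = 0"
    and Euler: "\<And>t x. t \<in> {0..T} \<Longrightarrow> x \<in> {0..1} \<Longrightarrow>
       \<bar>v t x - v 0 x - t * (\<mu> * (V 2 x + V 1 x * (H 1 x / H 0 x)) - V 0 x * V 1 x - H 1 x + f)\<bar> \<le> B * t\<^sup>2"
  obtains M where "M > 0"
    "\<And>dt n i. 0 < dt \<Longrightarrow> dt < T \<Longrightarrow> n \<ge> 2 \<Longrightarrow> i \<le> n \<Longrightarrow>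
       \<bar>step_v \<mu> dt (1 / real n) n f (\<lambda>i. h 0 (real i * (1 / real n))) (\<lambda>i. v 0 (real i * (1 / real n))) i
          - v dt (real i * (1 / real n))\<bar> \<le> M * dt * (dt + (1 / real n)\<^sup>2)"
proof -
  have H0pos: "\<And>x. x \<in> {0..1} \<Longrightarrow> H 0 x > 0" using pos H0 by simp
  obtain Bh where Bh: "Bh > 0" "\<And>x d. x - d \<in> {0..1} \<Longrightarrow> x + d \<in> {0..1} \<Longrightarrow> d > 0 \<Longrightarrow>
       \<bar>(H 0 (x + d) - H 0 (x - d)) / (2 * d) - H 1 x\<bar> \<le> Bh * d\<^sup>2"
    using centered_difference_bound[of 0 1 H] H contH by auto
  obtain Bv where Bv: "Bv > 0" "\<And>x d. x - d \<in> {0..1} \<Longrightarrow> x + d \<in> {0..1} \<Longrightarrow> d > 0 \<Longrightarrow>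
       \<bar>(V 0 (x + d) - V 0 (x - d)) / (2 * d) - V 1 x\<bar> \<le> Bv * d\<^sup>2"
    using centered_difference_bound[of 0 1 V] V contV by auto
  obtain Bs where Bs: "Bs > 0" "\<And>x d. x - d \<in> {0..1} \<Longrightarrow> x + d \<in> {0..1} \<Longrightarrow> d > 0 \<Longrightarrow>
       \<bar>(V 0 (x + d) - 2 * V 0 x + V 0 (x - d)) / d\<^sup>2 - V 2 x\<bar> \<le> Bs * d\<^sup>2"
    using second_difference_bound[of 0 1 V] V contV by auto
  obtain Bl where Bl: "Bl > 0" "\<And>x d. x - d \<in> {0..1} \<Longrightarrow> x + d \<in> {0..1} \<Longrightarrow> d > 0 \<Longrightarrow>
       \<bar>ln (H 0 (x + d) / H 0 (x - d)) / (2 * d) - H 1 x / H 0 x\<bar> \<le> Bl * d\<^sup>2"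
    using ln_centered_difference_bound[of 0 1 H] H contH H0pos by auto
  obtain K where K: "K > 0" "\<And>x. x \<in> {0..1} \<Longrightarrow> \<bar>V 0 x\<bar> \<le> K"
    using continuous_on_compact_abs_bound[OF compact_Icc contV[of 0]] by auto
  obtain K1 where K1: "K1 > 0" "\<And>x. x \<in> {0..1} \<Longrightarrow> \<bar>V 1 x\<bar> \<le> K1"
    using continuous_on_compact_abs_bound[OF compact_Icc contV[of 1]] by auto
  have "continuous_on {0..1} (\<lambda>x. H 1 x / H 0 x)"
    using H0pos by (force intro!: continuous_intros contH)
  then obtain L where L: "L > 0" "\<And>x. x \<in> {0..1} \<Longrightarrow> \<bar>H 1 x / H 0 x\<bar> \<le> L"
    using continuous_on_compact_abs_bound[OF compact_Icc] by blast
  \<comment> \<open>The factor of \<open>\<bar>\<mu>\<bar>\<close> collects the viscous errors, with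
    two terms for the product of the velocity and logarithm quotients; \<open>K * Bv\<close> belongs
    to convection and \<open>Bh\<close> to the gradient of \<open>h\<close>.\<close>
  define D where "D = \<bar>\<mu>\<bar> * (Bs + (Bv * (L + Bl) + K1 * Bl)) + K * Bv + Bh"
  define M where "M = D + \<bar>B\<bar>"
  have D: "D > 0"
    unfolding D_def using Bs Bv Bl K K1 L Bh
    by (intro add_nonneg_pos add_nonneg_nonneg mult_nonneg_nonneg) auto
  have "\<bar>step_v \<mu> dt (1 / real n) n f (\<lambda>i. h 0 (real i * (1 / real n))) (\<lambda>i. v 0 (real i * (1 / real n))) i
          - v dt (real i * (1 / real n))\<bar> \<le> M * dt * (dt + (1 / real n)\<^sup>2)"
    if dt: "0 < dt" "dt < T" and n: "n \<ge> 2" and i: "i \<le> n" for dt n i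
  proof (cases "i = 0 \<or> i = n")
    case True
    then have "v dt (real i * (1 / real n)) = 0" using bdry dt n by auto
    then show ?thesis using True D dt by (simp add: step_v_def M_def)
  next
    case False
    define dx where "dx = 1 / real n"
    define x where "x = real i * dx"
    have dx: "dx > 0" "real n * dx = 1" using n by (auto simp: dx_def)
    have "dx \<le> 1" using n by (simp add: dx_def)
    then have dx1: "dx\<^sup>2 \<le> 1" using dx by (simp add: power_le_one)
    have x: "x \<in> {0..1}" using i n unfolding x_def dx_def by (auto simp: field_simps)
    have xm: "real (i - 1) * dx = x - dx" and xp: "real (i + 1) * dx = x + dx"
      using False by (auto simp: x_def of_nat_diff algebra_simps)
    have "real (i + 1) * dx \<le> real n * dx" using False i dx by (intro mult_right_mono) auto
    moreover have "0 \<le> real (i - 1) * dx" using dx by simp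
    ultimately have xmp: "x - dx \<in> {0..1}" "x + dx \<in> {0..1}"
      unfolding xm xp dx(2) using dx(1) by auto
    define p where "p = (V 0 (x + dx) - V 0 (x - dx)) / (2 * dx)"
    define l where "l = ln (H 0 (x + dx) / H 0 (x - dx)) / (2 * dx)"
    define s where "s = (V 0 (x + dx) - 2 * V 0 x + V 0 (x - dx)) / dx\<^sup>2"
    define c where "c = (H 0 (x + dx) - H 0 (x - dx)) / (2 * dx)"
    define r where "r = \<mu> * (V 2 x + V 1 x * (H 1 x / H 0 x)) - V 0 x * V 1 x - H 1 x + f"
    define a where "a = \<mu> * (s + p * l) - V 0 x * p - c + f"
    have p: "\<bar>p - V 1 x\<bar> \<le> Bv * dx\<^sup>2" using Bv(2)[OF xmp dx(1)] unfolding p_def .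
    have l: "\<bar>l - H 1 x / H 0 x\<bar> \<le> Bl * dx\<^sup>2" using Bl(2)[OF xmp dx(1)] unfolding l_def .
    have s: "\<bar>s - V 2 x\<bar> \<le> Bs * dx\<^sup>2" using Bs(2)[OF xmp dx(1)] unfolding s_def .
    have c: "\<bar>c - H 1 x\<bar> \<le> Bh * dx\<^sup>2" using Bh(2)[OF xmp dx(1)] unfolding c_def .
    \<comment> \<open>The factor \<open>4 * dx\<^sup>2\<close> under the logarithmic term is shared
      between the two centered quotients, which turns that term into
      \<open>dt * \<mu> * (p * l)\<close>.\<close>
    have step: "step_v \<mu> dt dx n f (\<lambda>i. h 0 (real i * dx)) (\<lambda>i. v 0 (real i * dx)) i = V 0 x + dt * a"
      using False dx unfolding step_v_def xm xp x_def[symmetric] H0[symmetric] V0[symmetric] a_def p_def l_def s_def c_def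
      by (simp add: field_simps power2_eq_square)
    \<comment> \<open>Splitting the error of the product \<open>p * l\<close> leaves the discrete
      factor \<open>l\<close> in one term, so \<open>l\<close> itself needs a bound that does not
      depend on \<open>dx\<close>.\<close>
    have "Bl * dx\<^sup>2 \<le> Bl" using dx1 Bl by simp
    then have "\<bar>l\<bar> \<le> L + Bl" using l L(2)[OF x] by linarith
    then have "\<bar>(p - V 1 x) * l\<bar> \<le> (Bv * dx\<^sup>2) * (L + Bl)"
      unfolding abs_mult using p Bv by (intro mult_mono) auto
    moreover have "\<bar>V 1 x * (l - H 1 x / H 0 x)\<bar> \<le> K1 * (Bl * dx\<^sup>2)"
      unfolding abs_mult using l K1 x by (intro mult_mono) auto
    moreover have "p * l - V 1 x * (H 1 x / H 0 x) = (p - V 1 x) * l + V 1 x * (l - H 1 x / H 0 x)"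
      by (simp add: algebra_simps)
    ultimately have "\<bar>p * l - V 1 x * (H 1 x / H 0 x)\<bar> \<le> (Bv * dx\<^sup>2) * (L + Bl) + K1 * (Bl * dx\<^sup>2)"
      by linarith
    then have "\<bar>(s - V 2 x) + (p * l - V 1 x * (H 1 x / H 0 x))\<bar>
        \<le> Bs * dx\<^sup>2 + ((Bv * dx\<^sup>2) * (L + Bl) + K1 * (Bl * dx\<^sup>2))"
      using s by linarith
    then have 1: "\<bar>\<mu> * ((s - V 2 x) + (p * l - V 1 x * (H 1 x / H 0 x)))\<bar>
        \<le> \<bar>\<mu>\<bar> * (Bs * dx\<^sup>2 + ((Bv * dx\<^sup>2) * (L + Bl) + K1 * (Bl * dx\<^sup>2)))"
      unfolding abs_mult by (intro mult_left_mono) auto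
    have 2: "\<bar>V 0 x * (p - V 1 x)\<bar> \<le> K * (Bv * dx\<^sup>2)"
      unfolding abs_mult using p K x by (intro mult_mono) auto
    have "a - r = \<mu> * ((s - V 2 x) + (p * l - V 1 x * (H 1 x / H 0 x))) - V 0 x * (p - V 1 x) - (c - H 1 x)"
      unfolding a_def r_def by (simp add: algebra_simps)
    then have "\<bar>a - r\<bar> \<le> \<bar>\<mu>\<bar> * (Bs * dx\<^sup>2 + ((Bv * dx\<^sup>2) * (L + Bl) + K1 * (Bl * dx\<^sup>2))) + K * (Bv * dx\<^sup>2) + Bh * dx\<^sup>2"
      using 1 2 c by linarith
    also have "\<dots> = D * dx\<^sup>2" by (simp add: D_def algebra_simps)
    finally have "\<bar>dt * (a - r)\<bar> \<le> dt * (D * dx\<^sup>2)" using dt by (simp add: abs_mult)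
    moreover have "\<bar>v dt x - V 0 x - dt * r\<bar> \<le> B * dt\<^sup>2"
      using Euler[of dt x] dt x V0 unfolding r_def by simp
    moreover have "V 0 x + dt * a - v dt x = dt * (a - r) - (v dt x - V 0 x - dt * r)"
      by (simp add: algebra_simps)
    ultimately have "\<bar>V 0 x + dt * a - v dt x\<bar> \<le> dt * (D * dx\<^sup>2) + B * dt\<^sup>2" by linarith
    also have "\<dots> \<le> dt * (M * dx\<^sup>2) + M * dt\<^sup>2"
      using dt D by (intro add_mono mult_left_mono mult_right_mono) (auto simp: M_def)
    finally show ?thesis
      unfolding step[symmetric] by (simp add: dx_def x_def algebra_simps power2_eq_square)
  qed
  moreover have "M > 0" unfolding M_def using D by simp
  ultimately show thesis by (rule that[rotated])
qed


section \<open>The ODE components and the combined estimate\<close>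

text \<open>Along the differential equations \<open>\<zeta> - w + \<gamma> * \<xi>\<close> solves y'
  = -\<gamma> y, because the terms with f cancel; the scheme multiplies it by the exact factor
  \<open>exp (- \<gamma> * dt)\<close>. To first order in \<open>dt\<close> this reproduces the
  right-hand side for \<open>\<zeta>\<close>, leaving the quadratic term of \<open>step_xi\<close>
  and the remainder of the exponential.\<close>

lemma step_zeta_error:
  fixes \<gamma> dt :: real
  assumes "\<bar>\<gamma> * dt\<bar> \<le> 1"
  shows "\<bar>step_zeta \<gamma> dt f \<xi> w \<zeta> - \<zeta> - dt * (- \<gamma> * \<zeta> - \<gamma>\<^sup>2 * \<xi> - f)\<bar>
    \<le> (\<bar>\<gamma> * f\<bar> / 2 + \<gamma>\<^sup>2 * \<bar>\<zeta> - w + \<gamma> * \<xi>\<bar>) * dt\<^sup>2"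
proof -
  let ?e = "exp (- \<gamma> * dt) - 1 - (- \<gamma> * dt)"
  have "\<bar>?e\<bar> \<le> (- \<gamma> * dt)\<^sup>2" using assms by (intro abs_exp_sub_linear_le) simp
  then have "\<bar>?e * (\<zeta> - w + \<gamma> * \<xi>)\<bar> \<le> (- \<gamma> * dt)\<^sup>2 * \<bar>\<zeta> - w + \<gamma> * \<xi>\<bar>"
    unfolding abs_mult by (intro mult_right_mono) auto
  moreover have "\<bar>\<gamma> * f * dt\<^sup>2 / 2\<bar> = \<bar>\<gamma> * f\<bar> / 2 * dt\<^sup>2" by (simp add: abs_mult)
  moreover have "step_zeta \<gamma> dt f \<xi> w \<zeta> - \<zeta> - dt * (- \<gamma> * \<zeta> - \<gamma>\<^sup>2 * \<xi> - f)
      = \<gamma> * f * dt\<^sup>2 / 2 + ?e * (\<zeta> - w + \<gamma> * \<xi>)"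
    by (simp add: step_zeta_def step_w_def step_xi_def field_simps power2_eq_square)
  ultimately have "\<bar>step_zeta \<gamma> dt f \<xi> w \<zeta> - \<zeta> - dt * (- \<gamma> * \<zeta> - \<gamma>\<^sup>2 * \<xi> - f)\<bar>
      \<le> \<bar>\<gamma> * f\<bar> / 2 * dt\<^sup>2 + (- \<gamma> * dt)\<^sup>2 * \<bar>\<zeta> - w + \<gamma> * \<xi>\<bar>"
    by linarith
  then show ?thesis by (simp add: algebra_simps power_mult_distrib)
qed

lemma one_step_consistency:
  assumes T: "T > 0"
    and sol: "classical_solution 4 T \<mu> \<sigma> q k \<gamma> \<beta> lam \<xi> w h v \<zeta> z"
  shows "\<exists>M>0. \<exists>\<epsilon>>0. \<forall>(dt::real) (n::nat) (dx::real).
        0 < dt \<and> dt < T \<and> dt < \<epsilon> \<and> n \<ge> 2 \<and> dx = 1 / real n \<and> dx < \<epsilon>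
        \<longrightarrow>
        (let h0 = (\<lambda>i::nat. h 0 (real i * dx));
             v0 = (\<lambda>i::nat. v 0 (real i * dx));
             f = feedback \<mu> \<sigma> q k \<gamma> lam (\<xi> 0) (\<zeta> 0) (z 0) (h0 0) (h0 n)
         in \<bar>step_xi dt f (\<xi> 0) (w 0) - \<xi> dt\<bar>
            + \<bar>step_w dt f (w 0) - w dt\<bar>
            + \<bar>step_z \<mu> \<beta> dt f (z 0) (h0 0) (h0 n) - z dt\<bar>
            + \<bar>step_zeta \<gamma> dt f (\<xi> 0) (w 0) (\<zeta> 0) - \<zeta> dt\<bar>
            + (MAX i\<in>{0..n}. \<bar>step_h dt dx n h0 v0 i - h dt (real i * dx)\<bar>
                             + \<bar>step_v \<mu> dt dx n f h0 v0 i - v dt (real i * dx)\<bar>)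
            \<le> M * dt * (dt + dx\<^sup>2))"
proof -
  define F where "F t = feedback \<mu> \<sigma> q k \<gamma> lam (\<xi> t) (\<zeta> t) (z t) (h t 0) (h t 1)" for t
  define zd where "zd = F 0 - 1/2 * ((h 0 1)\<^sup>2 - (h 0 0)\<^sup>2) - \<beta> * (z 0 - \<mu> * (h 0 1 - h 0 0))"
  have Ck: "Ck_on 4 {0..T} \<xi>" "Ck_on 4 {0..T} w" "Ck_on 4 {0..T} \<zeta>" "Ck_on 4 {0..T} z"
    "Ck_on 4 ({0..T} \<times> {0..1}) (\<lambda>(t, x). h t x)" "Ck_on 4 ({0..T} \<times> {0..1}) (\<lambda>(t, x). v t x)"
    using sol unfolding classical_solution_def Let_def by blast+
  have T0: "0 \<in> {0..T}" using T by simp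
  have ode: "(\<xi> has_real_derivative w 0) (at 0 within {0..T})"
    "(w has_real_derivative - F 0) (at 0 within {0..T})"
    "(\<zeta> has_real_derivative (- \<gamma> * \<zeta> 0 - \<gamma>\<^sup>2 * \<xi> 0 - F 0)) (at 0 within {0..T})"
    "(z has_real_derivative zd) (at 0 within {0..T})"
    using sol T0 unfolding classical_solution_def Let_def F_def zd_def by blast+
  \<comment> \<open>The expansions start at time 0, so the partial differential equations are read
    off there; the wall values of \<open>v\<close> are kept for all times because
    \<open>v dt\<close> is compared with the zeros of the scheme.\<close>
  have pos: "\<And>x. x \<in> {0..1} \<Longrightarrow> h 0 x > 0"
    and bdry: "\<And>t. t \<in> {0..T} \<Longrightarrow> v t 0 = 0" "\<And>t. t \<in> {0..T} \<Longrightarrow> v t 1 = 0"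
    and mass: "\<And>x. x \<in> {0..1} \<Longrightarrow> pd_t T h 0 x + pd_x (\<lambda>t x. h t x * v t x) 0 x = 0"
    and mom: "\<And>x. x \<in> {0..1} \<Longrightarrow> pd_t T (\<lambda>t x. h t x * v t x) 0 x
             + pd_x (\<lambda>t x. h t x * (v t x)\<^sup>2 + 1/2 * (h t x)\<^sup>2) 0 x
           = \<mu> * pd_x (\<lambda>t x. h t x * pd_x v t x) 0 x + h 0 x * F 0"
    using sol T0 unfolding classical_solution_def Let_def F_def by blast+
  have ge2: "(2::nat) \<le> 4" by simp
  obtain B1 where B1: "B1 > 0" "\<And>t. t \<in> {0..T} \<Longrightarrow> \<bar>\<xi> t - \<xi> 0 - t * w 0\<bar> \<le> B1 * t\<^sup>2"
    using Euler_bound_Icc[OF Ck(1) ge2 T ode(1)] by blast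
  obtain B2 where B2: "B2 > 0" "\<And>t. t \<in> {0..T} \<Longrightarrow> \<bar>w t - w 0 - t * - F 0\<bar> \<le> B2 * t\<^sup>2"
    using Euler_bound_Icc[OF Ck(2) ge2 T ode(2)] by blast
  obtain B3 where B3: "B3 > 0"
    "\<And>t. t \<in> {0..T} \<Longrightarrow> \<bar>\<zeta> t - \<zeta> 0 - t * (- \<gamma> * \<zeta> 0 - \<gamma>\<^sup>2 * \<xi> 0 - F 0)\<bar> \<le> B3 * t\<^sup>2"
    using Euler_bound_Icc[OF Ck(3) ge2 T ode(3)] by blast
  obtain B4 where B4: "B4 > 0" "\<And>t. t \<in> {0..T} \<Longrightarrow> \<bar>z t - z 0 - t * zd\<bar> \<le> B4 * t\<^sup>2"
    using Euler_bound_Icc[OF Ck(4) ge2 T ode(4)] by blast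
  obtain ht Bh where "Bh > 0" and ht: "\<And>x. x \<in> {0..1} \<Longrightarrow> ((\<lambda>s. h s x) has_real_derivative ht x) (at 0 within {0..T})"
    "\<And>t x. t \<in> {0..T} \<Longrightarrow> x \<in> {0..1} \<Longrightarrow> \<bar>h t x - h 0 x - t * ht x\<bar> \<le> Bh * t\<^sup>2"
    by (rule Euler_bound_slices[OF Ck(5) ge2 T]) (rule that)
  obtain vt Bv where "Bv > 0" and vt: "\<And>x. x \<in> {0..1} \<Longrightarrow> ((\<lambda>s. v s x) has_real_derivative vt x) (at 0 within {0..T})"
    "\<And>t x. t \<in> {0..T} \<Longrightarrow> x \<in> {0..1} \<Longrightarrow> \<bar>v t x - v 0 x - t * vt x\<bar> \<le> Bv * t\<^sup>2"
    by (rule Euler_bound_slices[OF Ck(6) ge2 T]) (rule that)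
  obtain H where H: "H 0 = h 0"
    "\<And>i x. i < 4 \<Longrightarrow> x \<in> {0..1} \<Longrightarrow> (H i has_real_derivative H (Suc i) x) (at x within {0..1})"
    "\<And>i. i \<le> 4 \<Longrightarrow> continuous_on {0..1} (H i)"
    by (rule Ck_on_slice_derivatives[OF Ck(5) T0]) (rule that)
  obtain V where V: "V 0 = v 0"
    "\<And>i x. i < 4 \<Longrightarrow> x \<in> {0..1} \<Longrightarrow> (V i has_real_derivative V (Suc i) x) (at x within {0..1})"
    "\<And>i. i \<le> 4 \<Longrightarrow> continuous_on {0..1} (V i)"
    by (rule Ck_on_slice_derivatives[OF Ck(6) T0]) (rule that)
  have H2: "\<And>i x. i < 2 \<Longrightarrow> x \<in> {0..1} \<Longrightarrow> (H i has_real_derivative H (Suc i) x) (at x within {0..1})"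
    using H by simp
  have V2: "\<And>i x. i < 2 \<Longrightarrow> x \<in> {0..1} \<Longrightarrow> (V i has_real_derivative V (Suc i) x) (at x within {0..1})"
    using V by simp
  have ht_eq: "ht x = - (H 1 x * V 0 x + H 0 x * V 1 x)"
    and vt_eq: "vt x = \<mu> * (V 2 x + V 1 x * (H 1 x / H 0 x)) - V 0 x * V 1 x - H 1 x + F 0"
    if "x \<in> {0..1}" for x
    using time_derivatives_of_solution[where h = h and v = v and t = 0,
        OF T T0 that H(1) V(1) H2 V2 ht(1)[OF that] vt(1)[OF that] pos[OF that] mass[OF that] mom[OF that]]
    by blast+
  have Euler_h: "\<bar>h t x - h 0 x + t * (H 1 x * V 0 x + H 0 x * V 1 x)\<bar> \<le> Bh * t\<^sup>2"
    if "t \<in> {0..T}" "x \<in> {0..1}" for t x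
    using ht(2)[OF that] unfolding ht_eq[OF that(2)] by (simp only: mult_minus_right diff_minus_eq_add)
  have Euler_v: "\<bar>v t x - v 0 x - t * (\<mu> * (V 2 x + V 1 x * (H 1 x / H 0 x)) - V 0 x * V 1 x - H 1 x + F 0)\<bar>
      \<le> Bv * t\<^sup>2"
    if "t \<in> {0..T}" "x \<in> {0..1}" for t x
    using vt(2)[OF that] unfolding vt_eq[OF that(2)] .
  have H3: "\<And>i x. i < 3 \<Longrightarrow> x \<in> {0..1} \<Longrightarrow> (H i has_real_derivative H (Suc i) x) (at x within {0..1})"
    "\<And>i. i \<le> 3 \<Longrightarrow> continuous_on {0..1} (H i)"
    using H by simp_all
  have V3: "\<And>i x. i < 3 \<Longrightarrow> x \<in> {0..1} \<Longrightarrow> (V i has_real_derivative V (Suc i) x) (at x within {0..1})"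
    "\<And>i. i \<le> 3 \<Longrightarrow> continuous_on {0..1} (V i)"
    using V by simp_all
  obtain Mh \<epsilon>h where Mh: "Mh > 0" "\<epsilon>h > 0"
    "\<And>dt n i. 0 < dt \<Longrightarrow> dt < T \<Longrightarrow> dt < \<epsilon>h \<Longrightarrow> n \<ge> 2 \<Longrightarrow> i \<le> n \<Longrightarrow>
       \<bar>step_h dt (1 / real n) n (\<lambda>i. h 0 (real i * (1 / real n))) (\<lambda>i. v 0 (real i * (1 / real n))) i
          - h dt (real i * (1 / real n))\<bar> \<le> Mh * dt * (dt + (1 / real n)\<^sup>2)"
    by (rule step_h_error[where h = h and v = v,
          OF H(1) V(1) H3(1) V3(1) H3(2) V3(2) pos bdry(1)[OF T0] bdry(2)[OF T0] Euler_h])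
       (assumption+, rule that)
  obtain Mv where Mv: "Mv > 0"
    "\<And>dt n i. 0 < dt \<Longrightarrow> dt < T \<Longrightarrow> n \<ge> 2 \<Longrightarrow> i \<le> n \<Longrightarrow>
       \<bar>step_v \<mu> dt (1 / real n) n (F 0) (\<lambda>i. h 0 (real i * (1 / real n))) (\<lambda>i. v 0 (real i * (1 / real n))) i
          - v dt (real i * (1 / real n))\<bar> \<le> Mv * dt * (dt + (1 / real n)\<^sup>2)"
    by (rule step_v_error[where h = h and v = v,
          OF H(1) V(1) H3(1) V(2) H3(2) V(3) pos bdry(1) bdry(2) Euler_v])
       (assumption+, rule that)
  \<comment> \<open>The comparison is with a first-order expansion, so the term
    \<open>dt\<^sup>2 / 2 * f\<close> of \<open>step_xi\<close> counts as an error and contributes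
    \<open>\<bar>F 0\<bar> / 2\<close>.\<close>
  define C1 where "C1 = \<bar>F 0\<bar> / 2 + B1"
  define C3 where "C3 = \<bar>\<gamma> * F 0\<bar> / 2 + \<gamma>\<^sup>2 * \<bar>\<zeta> 0 - w 0 + \<gamma> * \<xi> 0\<bar> + B3"
  define C where "C = C1 + B2 + B4 + C3"
  define M where "M = C + (Mh + Mv)"
  \<comment> \<open>The second entry ensures \<open>\<bar>\<gamma> * dt\<bar> \<le> 1\<close>, as
    \<open>step_zeta_error\<close> requires; the added 1 keeps the denominator positive.\<close>
  define \<epsilon> where "\<epsilon> = min \<epsilon>h (1 / (\<bar>\<gamma>\<bar> + 1))"
  have C: "C > 0" unfolding C_def C1_def C3_def using B1 B2 B3 B4
    by (intro add_pos_pos add_nonneg_pos add_nonneg_nonneg) auto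
  have M: "M > 0" unfolding M_def using C Mh Mv by simp
  have \<epsilon>: "\<epsilon> > 0" unfolding \<epsilon>_def using Mh by simp
  show ?thesis
  proof (rule exI[of _ M], intro conjI M, rule exI[of _ \<epsilon>], intro conjI \<epsilon> allI impI)
    fix dt :: real and n :: nat and dx :: real
    assume "0 < dt \<and> dt < T \<and> dt < \<epsilon> \<and> n \<ge> 2 \<and> dx = 1 / real n \<and> dx < \<epsilon>"
    then have dt: "0 < dt" "dt < T" "dt < \<epsilon>h" "dt < 1 / (\<bar>\<gamma>\<bar> + 1)" and n: "n \<ge> 2" and dx: "dx = 1 / real n"
      unfolding \<epsilon>_def by auto
    have dtT: "dt \<in> {0..T}" using dt by simp
    \<comment> \<open>The end nodes are exactly 0 and 1, so the control computed from the grid is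
      \<open>F 0\<close> without any discretisation error.\<close>
    have ends: "real 0 * dx = 0" "real n * dx = 1" using n dx by auto
    have "dt * (\<bar>\<gamma>\<bar> + 1) < 1" using dt(4) by (simp add: field_simps)
    then have \<gamma>dt: "\<bar>\<gamma> * dt\<bar> \<le> 1" using dt(1) by (simp add: abs_mult algebra_simps)
    have "step_xi dt (F 0) (\<xi> 0) (w 0) - \<xi> dt = - (dt\<^sup>2 / 2 * F 0) - (\<xi> dt - \<xi> 0 - dt * w 0)"
      by (simp add: step_xi_def)
    moreover have "\<bar>dt\<^sup>2 / 2 * F 0\<bar> = \<bar>F 0\<bar> / 2 * dt\<^sup>2" by (simp add: abs_mult)
    ultimately have "\<bar>step_xi dt (F 0) (\<xi> 0) (w 0) - \<xi> dt\<bar> \<le> C1 * dt\<^sup>2"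
      using B1(2)[OF dtT] unfolding C1_def distrib_right by linarith
    moreover have "step_w dt (F 0) (w 0) - w dt = - (w dt - w 0 - dt * - F 0)"
      by (simp add: step_w_def)
    then have "\<bar>step_w dt (F 0) (w 0) - w dt\<bar> \<le> B2 * dt\<^sup>2"
      using B2(2)[OF dtT] by linarith
    moreover have "step_z \<mu> \<beta> dt (F 0) (z 0) (h 0 0) (h 0 1) - z dt = - (z dt - z 0 - dt * zd)"
      by (simp add: step_z_def zd_def)
    then have "\<bar>step_z \<mu> \<beta> dt (F 0) (z 0) (h 0 0) (h 0 1) - z dt\<bar> \<le> B4 * dt\<^sup>2"
      using B4(2)[OF dtT] by linarith
    moreover have "\<bar>step_zeta \<gamma> dt (F 0) (\<xi> 0) (w 0) (\<zeta> 0) - \<zeta> dt\<bar> \<le> C3 * dt\<^sup>2"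
      using step_zeta_error[OF \<gamma>dt, of "F 0" "\<xi> 0" "w 0" "\<zeta> 0"] B3(2)[OF dtT]
      unfolding C3_def distrib_right by linarith
    moreover have "(MAX i\<in>{0..n}. \<bar>step_h dt dx n (\<lambda>i. h 0 (real i * dx)) (\<lambda>i. v 0 (real i * dx)) i - h dt (real i * dx)\<bar>
         + \<bar>step_v \<mu> dt dx n (F 0) (\<lambda>i. h 0 (real i * dx)) (\<lambda>i. v 0 (real i * dx)) i - v dt (real i * dx)\<bar>)
        \<le> (Mh + Mv) * dt * (dt + dx\<^sup>2)"
    \<comment> \<open>\<open>Mh\<close> and \<open>Mv\<close> do not depend on the node, so bounding
      each entry suffices for the maximum.\<close>
    proof (subst Max_le_iff; (intro ballI)?)
      fix e assume "e \<in> (\<lambda>i. \<bar>step_h dt dx n (\<lambda>i. h 0 (real i * dx)) (\<lambda>i. v 0 (real i * dx)) i - h dt (real i * dx)\<bar>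
         + \<bar>step_v \<mu> dt dx n (F 0) (\<lambda>i. h 0 (real i * dx)) (\<lambda>i. v 0 (real i * dx)) i - v dt (real i * dx)\<bar>) ` {0..n}"
      then obtain i where i: "i \<le> n" and e: "e = \<bar>step_h dt dx n (\<lambda>i. h 0 (real i * dx)) (\<lambda>i. v 0 (real i * dx)) i - h dt (real i * dx)\<bar>
         + \<bar>step_v \<mu> dt dx n (F 0) (\<lambda>i. h 0 (real i * dx)) (\<lambda>i. v 0 (real i * dx)) i - v dt (real i * dx)\<bar>"
        by auto
      show "e \<le> (Mh + Mv) * dt * (dt + dx\<^sup>2)"
        using Mh(3)[OF dt(1,2,3) n i] Mv(2)[OF dt(1,2) n i] unfolding e dx distrib_right by linarith
    qed auto
    moreover have "C * dt\<^sup>2 \<le> C * dt * (dt + dx\<^sup>2)"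
      using C dt by (simp add: algebra_simps power2_eq_square)
    moreover have "C * dt\<^sup>2 = C1 * dt\<^sup>2 + B2 * dt\<^sup>2 + B4 * dt\<^sup>2 + C3 * dt\<^sup>2"
      by (simp add: C_def algebra_simps)
    moreover have "M * dt * (dt + dx\<^sup>2) = C * dt * (dt + dx\<^sup>2) + (Mh + Mv) * dt * (dt + dx\<^sup>2)"
      by (simp add: M_def algebra_simps)
    ultimately show "let h0 = (\<lambda>i::nat. h 0 (real i * dx));
             v0 = (\<lambda>i::nat. v 0 (real i * dx));
             f = feedback \<mu> \<sigma> q k \<gamma> lam (\<xi> 0) (\<zeta> 0) (z 0) (h0 0) (h0 n)
         in \<bar>step_xi dt f (\<xi> 0) (w 0) - \<xi> dt\<bar>
            + \<bar>step_w dt f (w 0) - w dt\<bar>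
            + \<bar>step_z \<mu> \<beta> dt f (z 0) (h0 0) (h0 n) - z dt\<bar>
            + \<bar>step_zeta \<gamma> dt f (\<xi> 0) (w 0) (\<zeta> 0) - \<zeta> dt\<bar>
            + (MAX i\<in>{0..n}. \<bar>step_h dt dx n h0 v0 i - h dt (real i * dx)\<bar>
                             + \<bar>step_v \<mu> dt dx n f h0 v0 i - v dt (real i * dx)\<bar>)
            \<le> M * dt * (dt + dx\<^sup>2)"
      unfolding Let_def ends F_def[symmetric] by linarith
  qed
qed

text \<open>The phrase "sufficiently large order" is rendered by an \<open>N\<close> quantified
  before all parameters and solutions, so one order must serve them all; the witness 4 is what the
  second difference of \<open>v\<close> demands. \<open>M\<close> and \<open>\<epsilon>\<close> are
  chosen after the solution but before \<open>dt\<close> and \<open>n\<close>, which is the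
  uniformity claimed for the constant.\<close>

theorem theorem4:
  "\<exists>N::nat. \<forall>(\<mu>::real) (Hmax::real) (\<sigma>::real) (q::real) (k::real) (\<gamma>::real) (\<beta>::real) (lam::real) (T::real)
      (\<xi>::real \<Rightarrow> real) (w::real \<Rightarrow> real) (h::real \<Rightarrow> real \<Rightarrow> real) (v::real \<Rightarrow> real \<Rightarrow> real)
      (\<zeta>::real \<Rightarrow> real) (z::real \<Rightarrow> real).
     \<mu> > 0 \<and> Hmax > 1 \<and> \<sigma> > 0 \<and> q > 0 \<and> k > 0 \<and> \<gamma> > 0 \<and> \<beta> > 0 \<and> lam \<in> {0..1} \<and> T > 0 \<and>
     classical_solution N T \<mu> \<sigma> q k \<gamma> \<beta> lam \<xi> w h v \<zeta> z \<and>
     (\<forall>t\<in>{0..T}. (\<xi> t, w t, h t, v t) \<in> X_space \<mu> q k Hmax)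
     \<longrightarrow>
     (\<exists>M>0. \<exists>\<epsilon>>0. \<forall>(dt::real) (n::nat) (dx::real).
        0 < dt \<and> dt < T \<and> dt < \<epsilon> \<and> n \<ge> 2 \<and> dx = 1 / real n \<and> dx < \<epsilon>
        \<longrightarrow>
        (let h0 = (\<lambda>i::nat. h 0 (real i * dx));
             v0 = (\<lambda>i::nat. v 0 (real i * dx));
             f = feedback \<mu> \<sigma> q k \<gamma> lam (\<xi> 0) (\<zeta> 0) (z 0) (h0 0) (h0 n)
         in \<bar>step_xi dt f (\<xi> 0) (w 0) - \<xi> dt\<bar>
            + \<bar>step_w dt f (w 0) - w dt\<bar>
            + \<bar>step_z \<mu> \<beta> dt f (z 0) (h0 0) (h0 n) - z dt\<bar>
            + \<bar>step_zeta \<gamma> dt f (\<xi> 0) (w 0) (\<zeta> 0) - \<zeta> dt\<bar>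
            + (MAX i\<in>{0..n}. \<bar>step_h dt dx n h0 v0 i - h dt (real i * dx)\<bar>
                             + \<bar>step_v \<mu> dt dx n f h0 v0 i - v dt (real i * dx)\<bar>)
            \<le> M * dt * (dt + dx\<^sup>2)))"
  by (intro exI[of _ "4::nat"] allI impI, elim conjE, rule one_step_consistency)

end
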